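(* Let $|N|\geq 4$ and $|O|=3$. Then the random serial dictatorship mechanism RSD attains the minimal bound of $\frac{1}{4}$ for at-most-$q$-object-wastefulness (i) in the class of mechanisms satisfying equal treatment of almost equals, strategy-proofness and ex-post weak non-wastefulness, and (ii) in the class of mechanisms satisfying equal treatment of equals, strategy-proofness and ex-post efficiency. That is, RSD belongs to each of these classes, RSD is at-most-$\frac14$-object-wasteful, and for every mechanism $f$ in the class, if $f$ is at-most-$q'$-object-wasteful, then $q'\geq\frac14$.
   Context: Model. $N=\{1,\ldots,n\}$ is a finite set of agents and $O$ a finite set of objects. Each agent $i$ has a strict preference $R_i$, a linear order over $O\cup\{i\}$, where $i$ stands for being unassigned; $P_i$ is its asymmetric part. $A(R_i)=\{o\in O: oP_ii\}$ is the set of acceptable objects, and $R_i|O$ is the restriction of $R_i$ to $O$. $\mathcal{R}^i$ is the set of all linear orders over $O\cup\{i\}$ and $\mathcal{R}^N=\times_{i\in N}\mathcal{R}^i$ is the set of profiles. An assignment is a map $\mu$ on $N$ with $\mu_i\in O\cup\{i\}$ for all $i$ and $\mu_i\neq\mu_j$ for $i\neq j$; $\mathcal{M}$ is the set of assignments and $\Delta(\mathcal{M})$ the set of probability distributions over $\mathcal{M}$. A mechanism is a map $f:\mathcal{R}^N\to\Delta(\mathcal{M})$; $f_{ia}(R)$ is the probability that $i$ is assigned $a\in O\cup\{i\}$ under $f(R)$, $f_i(R)=(f_{ia}(R))_{a\in O\cup\{i\}}$, and $f_{oo}(R)=1-\sum_{j\in N}f_{jo}(R)$ for $o\in O$. Properties.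 An assignment $\mu$ is efficient under $R$ if there is no assignment $\mu'$ with $\mu'_iR_i\mu_i$ for all $i$ and $\mu'_jP_j\mu_j$ for some $j$. It is weakly non-wasteful under $R$ if for all $i\in N$ and $x\in O\cup\{i\}$: $xR_i\mu_i$ and $iR_i\mu_i$ together imply that $\mu_j=x$ for some $j\in N$. $f$ is ex-post efficient (resp. ex-post weakly non-wasteful) if for every $R$ every assignment in the support of $f(R)$ is efficient (resp. weakly non-wasteful) under $R$. $f$ is strategy-proof if for all $R$, $i$, $R_i'\in\mathcal{R}^i$ and $x\in O\cup\{i\}$: $\sum_{y:\,yR_ix}f_{iy}(R)\ge\sum_{y:\,yR_ix}f_{iy}(R_i',R_{-i})$. $f$ satisfies equal treatment of equals if for all $R$ and $i,j\in N$, if $R_i=R_j$ (identifying the outside options $i$ and $j$) then $f_{io}(R)=f_{jo}(R)$ for all $o\in O$. $f$ satisfies equal treatment of almost equals if for all $R$ and all $i,j\in N$ with $R_i|O=R_j|O$ and $|A(R_i)|\le|A(R_j)|\le|A(R_i)|+1$, we have $f_{iy}(R)=f_{jy}(R)$ for all $y\in A(R_i)$. RSD. For a strict priority order $\succ$ over $N$, the serial dictatorship $f^{\succ}$ lets agents choose one after another in the order $\succ$; each agent receives his most preferred element among his outside option and the objects not chosen by earlier agents. With $\Pi$ the set of all strict priority orders over $N$, $RSD(R)=\frac{1}{n!}\sum_{\succ\in\Pi}f^{\succ}(R)$ for all $R$. Waste. For $q\in[0,1]$, $f$ is $q$-object-wasteful if there exist a profile $R$ and $o\in O$ with $\min\{\sum_{i\in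 N:\,oP_ii}f_{ii}(R),\,f_{oo}(R)\}\ge q$. $f$ is at-most-$q$-object-wasteful if $f$ is $q$-object-wasteful and not $q'$-object-wasteful for any $q'>q$. *)

theory Defs
  imports "HOL-Probability.Probability" "HOL-Combinatorics.Multiset_Permutations"
begin

text \<open>
  The agents are the elements of a finite type \<open>'i\<close> and the objects those of a finite type \<open>'o\<close>.
  The options of agent \<open>i\<close> (the set \<open>O \<union> {i}\<close>) are the elements of \<open>'o option\<close>: \<open>Some x\<close> is the
  object \<open>x\<close>, and \<open>None\<close> is the outside option of the agent at hand. Thus \<open>None\<close> denotes different
  options for different agents, and equality of two agents' preferences as relations on
  \<open>'o option\<close> is equality up to identification of their outside options.
\<close>

type_synonym 'o pref = "'o option rel"
type_synonym ('i, 'o) profile = "'i \<Rightarrow> 'o pref"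
type_synonym ('i, 'o) assignment = "'i \<Rightarrow> 'o option"
type_synonym ('i, 'o) mechanism = "('i, 'o) profile \<Rightarrow> ('i, 'o) assignment pmf"


subsection \<open>Preferences\<close>

text \<open>\<open>(a, b) \<in> r\<close> means that \<open>a\<close> is weakly preferred to \<open>b\<close>.\<close>

definition prefs :: "'o pref set" where
  "prefs = {r. linear_order_on UNIV r}"

definition profiles :: "('i, 'o) profile set" where
  "profiles = {R. \<forall>i. R i \<in> prefs}"

definition strictly_prefers :: "'o pref \<Rightarrow> 'o option \<Rightarrow> 'o option \<Rightarrow> bool" where
  "strictly_prefers r a b \<longleftrightarrow> (a, b) \<in> r \<and> (b, a) \<notin> r"

definition acceptable :: "'o pref \<Rightarrow> 'o set" where
  "acceptable r = {x. strictly_prefers r (Some x) None}"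

definition restrict_objects :: "'o pref \<Rightarrow> 'o rel" where
  "restrict_objects r = {(x, y). (Some x, Some y) \<in> r}"


subsection \<open>Assignments and mechanisms\<close>

text \<open>Outside options of different agents are different, so only coincidence on an object is
  excluded.\<close>

definition assignments :: "('i, 'o) assignment set" where
  "assignments = {\<mu>. \<forall>i j x. i \<noteq> j \<longrightarrow> \<mu> i = Some x \<longrightarrow> \<mu> j \<noteq> Some x}"

definition is_mechanism :: "('i, 'o) mechanism \<Rightarrow> bool" where
  "is_mechanism f \<longleftrightarrow> (\<forall>R\<in>profiles. set_pmf (f R) \<subseteq> assignments)"

definition share :: "('i, 'o) mechanism \<Rightarrow> ('i, 'o) profile \<Rightarrow> 'i \<Rightarrow> 'o option \<Rightarrow> real" where
  "share f R i a = measure_pmf.prob (f R) {\<mu>. \<mu> i = a}"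

definition unassigned_share ::
    "('i::finite, 'o) mechanism \<Rightarrow> ('i, 'o) profile \<Rightarrow> 'o \<Rightarrow> real" where
  "unassigned_share f R x = 1 - (\<Sum>j\<in>UNIV. share f R j (Some x))"


subsection \<open>Properties\<close>

definition efficient :: "('i, 'o) profile \<Rightarrow> ('i, 'o) assignment \<Rightarrow> bool" where
  "efficient R \<mu> \<longleftrightarrow>
     \<not> (\<exists>\<mu>'\<in>assignments. (\<forall>i. (\<mu>' i, \<mu> i) \<in> R i) \<and> (\<exists>j. strictly_prefers (R j) (\<mu>' j) (\<mu> j)))"

text \<open>Some agent receives the option \<open>a\<close> of agent \<open>i\<close>; the outside option of \<open>i\<close> can only be
  received by \<open>i\<close> itself.\<close>

definition is_assigned :: "('i, 'o) assignment \<Rightarrow> 'i \<Rightarrow> 'o option \<Rightarrow> bool" where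
  "is_assigned \<mu> i a = (case a of None \<Rightarrow> \<mu> i = None | Some x \<Rightarrow> \<exists>j. \<mu> j = Some x)"

definition weakly_non_wasteful :: "('i, 'o) profile \<Rightarrow> ('i, 'o) assignment \<Rightarrow> bool" where
  "weakly_non_wasteful R \<mu> \<longleftrightarrow>
     (\<forall>i a. (a, \<mu> i) \<in> R i \<and> (None, \<mu> i) \<in> R i \<longrightarrow> is_assigned \<mu> i a)"

definition ex_post_efficient :: "('i, 'o) mechanism \<Rightarrow> bool" where
  "ex_post_efficient f \<longleftrightarrow> (\<forall>R\<in>profiles. \<forall>\<mu>\<in>set_pmf (f R). efficient R \<mu>)"

definition ex_post_weakly_non_wasteful :: "('i, 'o) mechanism \<Rightarrow> bool" where
  "ex_post_weakly_non_wasteful f \<longleftrightarrow>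
     (\<forall>R\<in>profiles. \<forall>\<mu>\<in>set_pmf (f R). weakly_non_wasteful R \<mu>)"

definition strategy_proof :: "('i, 'o::finite) mechanism \<Rightarrow> bool" where
  "strategy_proof f \<longleftrightarrow>
     (\<forall>R\<in>profiles. \<forall>i. \<forall>r\<in>prefs. \<forall>a.
        (\<Sum>b | (b, a) \<in> R i. share f R i b) \<ge> (\<Sum>b | (b, a) \<in> R i. share f (R(i := r)) i b))"

definition equal_treatment_of_equals :: "('i, 'o) mechanism \<Rightarrow> bool" where
  "equal_treatment_of_equals f \<longleftrightarrow>
     (\<forall>R\<in>profiles. \<forall>i j. R i = R j \<longrightarrow> (\<forall>x. share f R i (Some x) = share f R j (Some x)))"

definition equal_treatment_of_almost_equals :: "('i, 'o::finite) mechanism \<Rightarrow> bool" where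
  "equal_treatment_of_almost_equals f \<longleftrightarrow>
     (\<forall>R\<in>profiles. \<forall>i j.
        restrict_objects (R i) = restrict_objects (R j) \<and>
        card (acceptable (R i)) \<le> card (acceptable (R j)) \<and>
        card (acceptable (R j)) \<le> card (acceptable (R i)) + 1 \<longrightarrow>
        (\<forall>x\<in>acceptable (R i). share f R i (Some x) = share f R j (Some x)))"


subsection \<open>Random serial dictatorship\<close>

definition favourite :: "'o pref \<Rightarrow> 'o option set \<Rightarrow> 'o option" where
  "favourite r A = (THE a. a \<in> A \<and> (\<forall>b\<in>A. (a, b) \<in> r))"

text \<open>The list gives the remaining agents in order of priority, \<open>X\<close> is the set of objects still
  available. An agent not in the list receives his outside option.\<close>

fun serial_dictatorship ::
    "'i list \<Rightarrow> ('i, 'o) profile \<Rightarrow> 'o set \<Rightarrow> ('i, 'o) assignment" where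
  "serial_dictatorship [] R X = (\<lambda>_. None)"
| "serial_dictatorship (i # is) R X =
     (let a = favourite (R i) (insert None (Some ` X))
      in (serial_dictatorship is R {x \<in> X. Some x \<noteq> a})(i := a))"

definition RSD :: "('i::finite, 'o) mechanism" where
  "RSD R = map_pmf (\<lambda>is. serial_dictatorship is R UNIV) (pmf_of_set (permutations_of_set UNIV))"


subsection \<open>Waste\<close>

definition object_wasteful :: "real \<Rightarrow> ('i::finite, 'o) mechanism \<Rightarrow> bool" where
  "object_wasteful q f \<longleftrightarrow> q \<in> {0..1} \<and>
     (\<exists>R\<in>profiles. \<exists>x.
        min (\<Sum>i | strictly_prefers (R i) (Some x) None. share f R i None)
            (unassigned_share f R x) \<ge> q)"

definition at_most_object_wasteful :: "real \<Rightarrow> ('i::finite, 'o) mechanism \<Rightarrow> bool" where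
  "at_most_object_wasteful q f \<longleftrightarrow>
     object_wasteful q f \<and> (\<forall>q'>q. \<not> object_wasteful q' f)"

definition attains_minimal_bound ::
    "('i::finite, 'o) mechanism \<Rightarrow> real \<Rightarrow> ('i, 'o) mechanism set \<Rightarrow> bool" where
  "attains_minimal_bound f q \<F> \<longleftrightarrow>
     f \<in> \<F> \<and> at_most_object_wasteful q f \<and>
     (\<forall>g\<in>\<F>. \<forall>q'. at_most_object_wasteful q' g \<longrightarrow> q' \<ge> q)"

end

theory Submission
  imports Defs
begin

text \<open>
  Lower bound. Equal treatment of equals, strategy-proofness and ex-post weak non-wastefulness
  suffice. Let four agents have the acceptable objects \<open>a c\<close>, \<open>b c\<close>, \<open>a\<close>, \<open>b\<close> in this order of
  preference, and let all others accept nothing. Then \<open>c\<close> remains unassigned with the same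
  probability as the one with which one of the first two agents remains unassigned. Strategy-proofness
  is only used in the form that reordering the top part of a truncated preference preserves the
  probability of that part; chaining such changes with equal treatment expresses this probability
  through five shares at other profiles, and these cancel except for the constant \<open>1/4\<close>.

  Upper bound for RSD. Waste of \<open>c\<close> requires exactly two agents \<open>i\<close>, \<open>j\<close> who accept \<open>c\<close>. If \<open>i\<close> can end up
  empty-handed although \<open>i\<close>, \<open>j\<close> can also receive the other two objects, then two further agents
  compete for these objects. Leaving \<open>c\<close> unassigned forces the earlier one of \<open>i\<close>, \<open>j\<close> to be the first of the
  four and the later one to precede a particular competitor, which has probability at most
  \<open>2 * (1/4 * 1/2)\<close>.
\<close>


section \<open>Preferences\<close>

lemma pref_refl: "r \<in> prefs \<Longrightarrow> (a, a) \<in> r"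
  by (auto simp: prefs_def order_on_defs refl_on_def)

lemma pref_trans: "r \<in> prefs \<Longrightarrow> (a, b) \<in> r \<Longrightarrow> (b, c) \<in> r \<Longrightarrow> (a, c) \<in> r"
  by (auto simp: prefs_def order_on_defs dest: transD)

lemma pref_antisym: "r \<in> prefs \<Longrightarrow> (a, b) \<in> r \<Longrightarrow> (b, a) \<in> r \<Longrightarrow> a = b"
  by (auto simp: prefs_def order_on_defs dest: antisymD)

lemma pref_total: "r \<in> prefs \<Longrightarrow> (a, b) \<in> r \<or> (b, a) \<in> r"
  by (cases "a = b") (auto simp: prefs_def order_on_defs refl_on_def total_on_def)

lemma strictly_prefers_iff: "r \<in> prefs \<Longrightarrow> strictly_prefers r a b \<longleftrightarrow> (b, a) \<notin> r"
  using pref_total by (auto simp: strictly_prefers_def)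

lemma acceptable_iff: "r \<in> prefs \<Longrightarrow> x \<in> acceptable r \<longleftrightarrow> (None, Some x) \<notin> r"
  by (simp add: acceptable_def strictly_prefers_iff)

lemma profilesD: "R \<in> profiles \<Longrightarrow> R i \<in> prefs"
  by (simp add: profiles_def)

lemma profiles_upd: "R \<in> profiles \<Longrightarrow> r \<in> prefs \<Longrightarrow> R(i := r) \<in> profiles"
  by (simp add: profiles_def)

lemma favourite_eqI:
  assumes "r \<in> prefs" "a \<in> A" "\<And>b. b \<in> A \<Longrightarrow> (a, b) \<in> r"
  shows "favourite r A = a"
  unfolding favourite_def using assms pref_antisym by (intro the_equality) blast+

lemma pref_has_best:
  assumes "r \<in> prefs" "finite A" "A \<noteq> {}"
  shows "\<exists>a\<in>A. \<forall>b\<in>A. (a, b) \<in> r"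
  using assms(2,3)
proof (induction A rule: finite_ne_induct)
  case (singleton x)
  then show ?case using pref_refl[OF assms(1)] by simp
next
  case (insert x A)
  then obtain a where "a \<in> A" "\<forall>b\<in>A. (a, b) \<in> r" by blast
  then show ?case
    using pref_total[OF assms(1), of a x] pref_trans[OF assms(1)] pref_refl[OF assms(1)] by blast
qed

lemma favourite:
  assumes "r \<in> prefs" "finite A" "A \<noteq> {}"
  shows favourite_in: "favourite r A \<in> A"
    and favourite_best: "b \<in> A \<Longrightarrow> (favourite r A, b) \<in> r"
proof -
  obtain a where a: "a \<in> A" "\<forall>b\<in>A. (a, b) \<in> r" using pref_has_best[OF assms] by blast
  then have "favourite r A = a" using assms(1) by (blast intro: favourite_eqI)
  with a show "favourite r A \<in> A" "b \<in> A \<Longrightarrow> (favourite r A, b) \<in> r" by auto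
qed


section \<open>Consequences of efficiency\<close>

text \<open>Otherwise handing the free object \<open>x\<close> to \<open>i\<close> alone would be a
  feasible Pareto improvement.\<close>

lemma efficient_unassigned:
  assumes "R \<in> profiles" "\<mu> \<in> assignments" "efficient R \<mu>" "\<And>j. \<mu> j \<noteq> Some x"
  shows "(\<mu> i, Some x) \<in> R i"
proof (rule ccontr)
  assume *: "(\<mu> i, Some x) \<notin> R i"
  have "\<mu>(i := Some x) \<in> assignments" using assms(2,4) by (auto simp: assignments_def)
  moreover have "\<forall>k. ((\<mu>(i := Some x)) k, \<mu> k) \<in> R k"
    using * pref_refl pref_total profilesD[OF assms(1)] by (metis fun_upd_apply)
  moreover have "strictly_prefers (R i) ((\<mu>(i := Some x)) i) (\<mu> i)"
    using * by (simp add: strictly_prefers_iff profilesD[OF assms(1)])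
  ultimately show False using assms(3) unfolding efficient_def by blast
qed

lemma efficient_individually_rational:
  assumes "R \<in> profiles" "\<mu> \<in> assignments" "efficient R \<mu>"
  shows "(\<mu> i, None) \<in> R i"
proof (rule ccontr)
  assume *: "(\<mu> i, None) \<notin> R i"
  have "\<mu>(i := None) \<in> assignments" using assms(2) by (auto simp: assignments_def)
  moreover have "\<forall>k. ((\<mu>(i := None)) k, \<mu> k) \<in> R k"
    using * pref_refl pref_total profilesD[OF assms(1)] by (metis fun_upd_apply)
  moreover have "strictly_prefers (R i) ((\<mu>(i := None)) i) (\<mu> i)"
    using * by (simp add: strictly_prefers_iff profilesD[OF assms(1)])
  ultimately show False using assms(3) unfolding efficient_def by blast
qed

text \<open>Individual rationality reduces the premise of weak non-wastefulness to
  \<open>\<mu> i = None\<close>; any object that \<open>i\<close> wants in that case must be taken,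
  since free objects are never preferred.\<close>

lemma efficient_weakly_non_wasteful:
  assumes "R \<in> profiles" "\<mu> \<in> assignments" "efficient R \<mu>"
  shows "weakly_non_wasteful R \<mu>"
  unfolding weakly_non_wasteful_def
proof (intro allI impI)
  fix i a assume "(a, \<mu> i) \<in> R i \<and> (None, \<mu> i) \<in> R i"
  then have a: "(a, \<mu> i) \<in> R i" and "\<mu> i = None"
    using efficient_individually_rational[OF assms] pref_antisym[OF profilesD[OF assms(1)]] by blast+
  show "is_assigned \<mu> i a"
  proof (cases a)
    case None
    with \<open>\<mu> i = None\<close> show ?thesis by (simp add: is_assigned_def)
  next
    case (Some x)
    then show ?thesis
      using efficient_unassigned[OF assms, of x i] a pref_antisym[OF profilesD[OF assms(1)]]
      by (fastforce simp: is_assigned_def)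
  qed
qed

lemma ex_post_efficient_imp_weakly_non_wasteful:
  "is_mechanism f \<Longrightarrow> ex_post_efficient f \<Longrightarrow> ex_post_weakly_non_wasteful f"
  unfolding is_mechanism_def ex_post_efficient_def ex_post_weakly_non_wasteful_def
  by (blast intro: efficient_weakly_non_wasteful)


section \<open>Weakly non-wasteful assignments\<close>

lemma weakly_non_wasteful_acceptable:
  assumes "R \<in> profiles" "weakly_non_wasteful R \<mu>" "\<mu> i = Some x"
  shows "x \<in> acceptable (R i)"
proof (rule ccontr)
  assume "x \<notin> acceptable (R i)"
  then have "(None, \<mu> i) \<in> R i" by (simp add: assms(3) acceptable_iff profilesD[OF assms(1)])
  then have "is_assigned \<mu> i None" using assms(2) unfolding weakly_non_wasteful_def by blast
  with assms(3) show False by (simp add: is_assigned_def)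
qed

lemma weakly_non_wasteful_assigned:
  assumes "R \<in> profiles" "weakly_non_wasteful R \<mu>" "\<mu> i = None" "x \<in> acceptable (R i)"
  shows "\<exists>j. \<mu> j = Some x"
proof -
  have "(Some x, \<mu> i) \<in> R i" "(None, \<mu> i) \<in> R i"
    using assms(3,4) pref_refl[OF profilesD[OF assms(1)]]
    by (auto simp: acceptable_def strictly_prefers_def)
  then have "is_assigned \<mu> i (Some x)" using assms(2) unfolding weakly_non_wasteful_def by blast
  then show ?thesis by (simp add: is_assigned_def)
qed

text \<open>If \<open>x\<close> stayed free, every agent in \<open>K\<close> would hold some object.
  These objects are distinct, acceptable and different from \<open>x\<close>, and there are too few
  of them.\<close>

lemma weakly_non_wasteful_pigeonhole:
  fixes R :: "('i, 'o::finite) profile"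
  assumes "R \<in> profiles" "weakly_non_wasteful R \<mu>" "\<mu> \<in> assignments"
    and K: "\<And>k. k \<in> K \<Longrightarrow> x \<in> acceptable (R k)"
    and card: "card ((\<Union>k\<in>K. acceptable (R k)) - {x}) < card K"
  shows "\<exists>j. \<mu> j = Some x"
proof (rule ccontr)
  assume no: "\<nexists>j. \<mu> j = Some x"
  have some: "\<mu> k \<noteq> None" if "k \<in> K" for k
    using weakly_non_wasteful_assigned[OF assms(1,2) _ K[OF that]] no by blast
  have "inj_on (\<lambda>k. the (\<mu> k)) K"
  proof (rule inj_onI)
    fix k l assume kl: "k \<in> K" "l \<in> K" "the (\<mu> k) = the (\<mu> l)"
    then have "\<mu> k = Some (the (\<mu> k))" "\<mu> l = Some (the (\<mu> k))"
      by (metis some option.collapse)+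
    then show "k = l" using assms(3) unfolding assignments_def by blast
  qed
  moreover have "(\<lambda>k. the (\<mu> k)) ` K \<subseteq> (\<Union>k\<in>K. acceptable (R k)) - {x}"
    using some no weakly_non_wasteful_acceptable[OF assms(1,2)] by fastforce
  ultimately have "card K \<le> card ((\<Union>k\<in>K. acceptable (R k)) - {x})"
    by (intro card_inj_on_le) auto
  with card show False by simp
qed


section \<open>Shares\<close>

lemma sum_share_eq_prob:
  fixes f :: "('i, 'o::finite) mechanism"
  shows "(\<Sum>a\<in>A. share f R i a) = measure_pmf.prob (f R) {\<mu>. \<mu> i \<in> A}"
proof -
  have "{\<mu>. \<mu> i \<in> A} = (\<Union>a\<in>A. {\<mu>. \<mu> i = a})" by auto
  then show ?thesis
    unfolding share_def
    by (subst measure_pmf.finite_measure_finite_Union[symmetric]) (auto simp: disjoint_family_on_def)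
qed

lemma sum_share_agents:
  fixes f :: "('i::finite, 'o) mechanism"
  assumes "is_mechanism f" "R \<in> profiles"
  shows "(\<Sum>i\<in>UNIV. share f R i (Some x)) = measure_pmf.prob (f R) {\<mu>. \<exists>i. \<mu> i = Some x}"
proof -
  \<comment> \<open>The events for different agents are disjoint only on \<open>assignments\<close>;
    intersecting with this set costs no probability.\<close>
  let ?B = "\<lambda>i. {\<mu> \<in> assignments. \<mu> i = Some x}"
  have supp: "AE \<mu> in f R. \<mu> \<in> assignments"
    using assms by (auto simp: is_mechanism_def AE_measure_pmf_iff)
  have "(\<Sum>i\<in>UNIV. share f R i (Some x)) = (\<Sum>i\<in>UNIV. measure_pmf.prob (f R) (?B i))"
    unfolding share_def using supp
    by (intro sum.cong refl measure_pmf.finite_measure_eq_AE) auto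
  also have "\<dots> = measure_pmf.prob (f R) (\<Union>i. ?B i)"
    by (rule measure_pmf.finite_measure_finite_Union[symmetric])
      (auto simp: disjoint_family_on_def assignments_def)
  also have "\<dots> = measure_pmf.prob (f R) {\<mu>. \<exists>i. \<mu> i = Some x}"
    using supp by (intro measure_pmf.finite_measure_eq_AE) auto
  finally show ?thesis .
qed

lemma unassigned_share_eq:
  fixes f :: "('i::finite, 'o) mechanism"
  assumes "is_mechanism f" "R \<in> profiles"
  shows "unassigned_share f R x = measure_pmf.prob (f R) {\<mu>. \<forall>i. \<mu> i \<noteq> Some x}"
proof -
  have "{\<mu>. \<forall>i. \<mu> i \<noteq> Some x} = space (measure_pmf (f R)) - {\<mu>. \<exists>i. \<mu> i = Some x}" by auto
  then show ?thesis
    using measure_pmf.prob_compl[of "{\<mu>. \<exists>i. \<mu> i = Some x}" "f R"]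
    unfolding unassigned_share_def sum_share_agents[OF assms] by simp
qed

lemma share_unacceptable:
  assumes "ex_post_weakly_non_wasteful f" "R \<in> profiles" "x \<notin> acceptable (R i)"
  shows "share f R i (Some x) = 0"
  unfolding share_def measure_pmf_zero_iff
  using assms weakly_non_wasteful_acceptable by (fastforce simp: ex_post_weakly_non_wasteful_def)

lemma share_None:
  fixes f :: "('i, 'o::finite) mechanism"
  assumes "ex_post_weakly_non_wasteful f" "R \<in> profiles"
  shows "share f R i None = 1 - (\<Sum>x\<in>acceptable (R i). share f R i (Some x))"
proof -
  have "1 = (\<Sum>a\<in>UNIV. share f R i a)"
    using sum_share_eq_prob[of f R i UNIV] by simp
  also have "\<dots> = share f R i None + (\<Sum>x\<in>UNIV. share f R i (Some x))"
    by (simp add: UNIV_option_conv sum.reindex)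
  also have "(\<Sum>x\<in>UNIV. share f R i (Some x)) = (\<Sum>x\<in>acceptable (R i). share f R i (Some x))"
    by (rule sum.mono_neutral_right) (auto intro: share_unacceptable[OF assms])
  finally show ?thesis by simp
qed

text \<open>Source of all balance equations below: the pigeonhole argument applies to every
  assignment in the support, so \<open>x\<close> is handed out in full.\<close>

lemma sum_share_pigeonhole:
  fixes f :: "('i::finite, 'o::finite) mechanism"
  assumes "is_mechanism f" "ex_post_weakly_non_wasteful f" "R \<in> profiles"
    and "\<And>k. k \<in> K \<Longrightarrow> x \<in> acceptable (R k)"
    and "card ((\<Union>k\<in>K. acceptable (R k)) - {x}) < card K"
  shows "(\<Sum>i\<in>UNIV. share f R i (Some x)) = 1"
proof -
  have "\<exists>i. \<mu> i = Some x" if "\<mu> \<in> set_pmf (f R)" for \<mu>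
  proof (rule weakly_non_wasteful_pigeonhole[OF assms(3) _ _ assms(4,5)])
    show "weakly_non_wasteful R \<mu>" "\<mu> \<in> assignments"
      using that assms(1-3) by (auto simp: ex_post_weakly_non_wasteful_def is_mechanism_def)
  qed
  then have "measure_pmf.prob (f R) {\<mu>. \<exists>i. \<mu> i = Some x} = 1"
    by (intro measure_pmf.prob_eq_1[THEN iffD2]) (auto simp: AE_measure_pmf_iff)
  then show ?thesis by (simp add: sum_share_agents[OF assms(1,3)])
qed

text \<open>The stronger axiom only speaks of acceptable objects; on the others both shares vanish
  by weak non-wastefulness.\<close>

lemma equal_treatment_of_almost_equals_imp_equals:
  assumes "ex_post_weakly_non_wasteful f" "equal_treatment_of_almost_equals f"
  shows "equal_treatment_of_equals f"
  unfolding equal_treatment_of_equals_def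
proof (intro ballI allI impI)
  fix R :: "('a, 'b) profile" and i j x
  assume R: "R \<in> profiles" and eq: "R i = R j"
  show "share f R i (Some x) = share f R j (Some x)"
  proof (cases "x \<in> acceptable (R i)")
    case True
    then show ?thesis using assms(2) R eq by (auto simp: equal_treatment_of_almost_equals_def)
  next
    case False
    then show ?thesis using share_unacceptable[OF assms(1) R] eq by metis
  qed
qed


section \<open>Truncated preferences\<close>

fun ranking :: "'a list \<Rightarrow> 'a rel" where
  "ranking [] = {}"
| "ranking (x # xs) = {x} \<times> set (x # xs) \<union> ranking xs"

lemma ranking_subset: "ranking xs \<subseteq> set xs \<times> set xs"
  by (induction xs) auto

lemma linear_order_ranking: "distinct xs \<Longrightarrow> linear_order_on (set xs) (ranking xs)"
proof (induction xs)
  case (Cons x xs)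
  then have lin: "linear_order_on (set xs) (ranking xs)" and x: "x \<notin> set xs" by auto
  have "trans (ranking (x # xs))" "antisym (ranking (x # xs))"
    using lin x ranking_subset[of xs]
    by (fastforce simp: order_on_defs intro!: transI antisymI dest: transD antisymD)+
  moreover have "refl_on (set (x # xs)) (ranking (x # xs))" "total_on (set (x # xs)) (ranking (x # xs))"
    "ranking (x # xs) \<subseteq> set (x # xs) \<times> set (x # xs)"
    using lin ranking_subset[of xs] by (auto simp: order_on_defs refl_on_def total_on_def)
  ultimately show ?case by (simp add: order_on_defs)
qed (simp add: order_on_defs refl_on_def total_on_def trans_def antisym_def)

text \<open>Prefixes of the list are upper contour sets, the sets over which strategy-proofness
  compares probabilities.\<close>

lemma ranking_upper_set:
  "distinct (xs @ ys) \<Longrightarrow> xs \<noteq> [] \<Longrightarrow> {b. (b, last xs) \<in> ranking (xs @ ys)} = set xs"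
proof (induction xs)
  case (Cons x xs)
  show ?case
  proof (cases "xs = []")
    case True
    then show ?thesis using Cons.prems ranking_subset[of ys] by auto
  next
    case False
    then have "{b. (b, last xs) \<in> ranking (xs @ ys)} = set xs" "last xs \<in> set xs"
      using Cons by simp_all
    moreover have "{b. (b, last (x # xs)) \<in> ranking ((x # xs) @ ys)} =
        {b. b = x \<and> last xs \<in> set (x # xs @ ys)} \<union> {b. (b, last xs) \<in> ranking (xs @ ys)}"
      using False by auto
    ultimately show ?thesis by auto
  qed
qed simp

text \<open>Unlisted objects follow the outside option in some fixed order, and
  \<open>remdups\<close> makes the result a linear order for every list.\<close>

definition truncated_pref :: "'o::finite list \<Rightarrow> 'o pref" where
  "truncated_pref xs =
     ranking (map Some (remdups xs) @ None # map Some (SOME ys. distinct ys \<and> set ys = - set xs))"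

lemma truncated_pref_eq_ranking:
  fixes xs :: "'o::finite list"
  obtains ys where "set ys = - set xs" "distinct (map Some (remdups xs) @ None # map Some ys)"
    "truncated_pref xs = ranking (map Some (remdups xs) @ None # map Some ys)"
proof -
  have "\<exists>ys. distinct ys \<and> set ys = - set xs"
    using finite_distinct_list[of "- set xs"] by auto
  from someI_ex[OF this] show ?thesis
    by (intro that) (auto simp: truncated_pref_def distinct_map)
qed

lemma truncated_pref_in_prefs: "truncated_pref xs \<in> prefs"
proof -
  obtain ys where ys: "set ys = - set xs" "distinct (map Some (remdups xs) @ None # map Some ys)"
      "truncated_pref xs = ranking (map Some (remdups xs) @ None # map Some ys)"
    by (rule truncated_pref_eq_ranking)
  have "set (map Some (remdups xs) @ None # map Some ys) = UNIV"
    using ys(1) notin_range_Some by fastforce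
  with linear_order_ranking[OF ys(2)] ys(3) show ?thesis by (simp add: prefs_def)
qed

lemma truncated_pref_upper_set:
  assumes "distinct (xs @ ys)" "xs \<noteq> []"
  shows "{b. (b, Some (last xs)) \<in> truncated_pref (xs @ ys)} = Some ` set xs"
proof -
  obtain zs where zs: "distinct (map Some (remdups (xs @ ys)) @ None # map Some zs)"
      "truncated_pref (xs @ ys) = ranking (map Some (remdups (xs @ ys)) @ None # map Some zs)"
    by (rule truncated_pref_eq_ranking)
  have "distinct (map Some xs @ map Some ys @ None # map Some zs)"
    using zs(1) distinct_remdups_id[OF assms(1)] by simp
  from ranking_upper_set[OF this] show ?thesis
    using assms zs(2) by (simp add: last_map distinct_remdups_id)
qed

lemma acceptable_truncated_pref: "acceptable (truncated_pref xs) = set xs"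
proof -
  obtain ys where ys: "distinct (map Some (remdups xs) @ None # map Some ys)"
      "truncated_pref xs = ranking (map Some (remdups xs) @ None # map Some ys)"
    by (rule truncated_pref_eq_ranking)
  \<comment> \<open>Ending the prefix with \<open>None\<close> yields the upper contour set of the
    outside option.\<close>
  from ys(1) have "distinct ((map Some (remdups xs) @ [None]) @ map Some ys)" by simp
  from ranking_upper_set[OF this]
  have up: "{b. (b, None) \<in> truncated_pref xs} = insert None (Some ` set xs)"
    using ys(2) by simp
  have "x \<in> acceptable (truncated_pref xs) \<longleftrightarrow> x \<in> set xs" for x
  proof -
    have "(None, Some x) \<notin> truncated_pref xs \<longleftrightarrow> (Some x, None) \<in> truncated_pref xs"
      using truncated_pref_in_prefs[of xs] pref_total pref_antisym by blast
    then show ?thesis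
      using up by (auto simp: acceptable_iff truncated_pref_in_prefs)
  qed
  then show ?thesis by blast
qed


section \<open>The lower bound\<close>

text \<open>These hypotheses hold in both classes of the theorem, so one lower bound serves
  both.\<close>

locale fair_mechanism =
  fixes f :: "('i::finite, 'o::finite) mechanism"
  assumes mechanism: "is_mechanism f"
    and equals: "equal_treatment_of_equals f"
    and strategy_proof: "strategy_proof f"
    and non_wasteful: "ex_post_weakly_non_wasteful f"
begin

text \<open>Both reports have the same upper contour set \<open>set xs\<close>. Strategy-proofness,
  applied once with each of them as the true preference, gives the two inequalities.\<close>

lemma share_upper_set_eq:
  assumes R: "R \<in> profiles" and "R i = truncated_pref (xs @ ys)"
    and xs: "distinct (xs @ ys)" "distinct (xs' @ ys')" "set xs = set xs'"
  shows "(\<Sum>x\<in>set xs. share f R i (Some x)) =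
         (\<Sum>x\<in>set xs. share f (R(i := truncated_pref (xs' @ ys'))) i (Some x))"
proof (cases "xs = []")
  case False
  let ?r = "truncated_pref (xs' @ ys')"
  have "xs' \<noteq> []" using False xs(3) by auto
  then have U: "{b. (b, Some (last xs)) \<in> R i} = Some ` set xs"
    "{b. (b, Some (last xs')) \<in> (R(i := ?r)) i} = Some ` set xs"
    using truncated_pref_upper_set[OF xs(1)] truncated_pref_upper_set[OF xs(2)] assms(2) xs(3) False
    by auto
  have r: "?r \<in> prefs" "R(i := ?r) \<in> profiles" "R i \<in> prefs"
    using truncated_pref_in_prefs R by (auto intro: profiles_upd profilesD)
  have "(\<Sum>b\<in>Some ` set xs. share f R i b) \<ge> (\<Sum>b\<in>Some ` set xs. share f (R(i := ?r)) i b)"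
    using strategy_proof R r(1) U(1) unfolding strategy_proof_def by metis
  moreover have "(\<Sum>b\<in>Some ` set xs. share f (R(i := ?r)) i b)
      \<ge> (\<Sum>b\<in>Some ` set xs. share f ((R(i := ?r))(i := R i)) i b)"
    using strategy_proof r(2,3) U(2) unfolding strategy_proof_def by metis
  ultimately show ?thesis by (simp add: sum.reindex)
qed simp

end

section \<open>Profiles with four active agents\<close>

definition profile4 ::
    "'i \<Rightarrow> 'i \<Rightarrow> 'i \<Rightarrow> 'i \<Rightarrow> 'o list \<Rightarrow> 'o list \<Rightarrow> 'o list \<Rightarrow> 'o list \<Rightarrow> ('i, 'o::finite) profile" where
  "profile4 i1 i2 i3 i4 p1 p2 p3 p4 =
     (\<lambda>_. truncated_pref [])(i1 := truncated_pref p1, i2 := truncated_pref p2,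
        i3 := truncated_pref p3, i4 := truncated_pref p4)"

locale four_agents = fair_mechanism f for f :: "('i::finite, 'o::finite) mechanism" +
  fixes i1 i2 i3 i4 :: 'i and a b c :: 'o
  assumes agents: "distinct [i1, i2, i3, i4]"
    and objects: "distinct [a, b, c]"
begin

definition S :: "'i \<Rightarrow> 'o list \<Rightarrow> 'o list \<Rightarrow> 'o list \<Rightarrow> 'o list \<Rightarrow> 'o \<Rightarrow> real" where
  "S i p1 p2 p3 p4 x = share f (profile4 i1 i2 i3 i4 p1 p2 p3 p4) i (Some x)"

lemma profile4_profiles: "profile4 i1 i2 i3 i4 p1 p2 p3 p4 \<in> profiles"
  by (auto simp: profiles_def profile4_def truncated_pref_in_prefs)

lemma distinct_agents [simp]:
  "i1 \<noteq> i2" "i1 \<noteq> i3" "i1 \<noteq> i4" "i2 \<noteq> i3" "i2 \<noteq> i4" "i3 \<noteq> i4"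
  "i2 \<noteq> i1" "i3 \<noteq> i1" "i4 \<noteq> i1" "i3 \<noteq> i2" "i4 \<noteq> i2" "i4 \<noteq> i3"
  using agents by auto

lemma distinct_objects [simp]: "a \<noteq> b" "a \<noteq> c" "b \<noteq> c" "b \<noteq> a" "c \<noteq> a" "c \<noteq> b"
  using objects by auto

lemma profile4_apply:
  "profile4 i1 i2 i3 i4 p1 p2 p3 p4 i1 = truncated_pref p1"
  "profile4 i1 i2 i3 i4 p1 p2 p3 p4 i2 = truncated_pref p2"
  "profile4 i1 i2 i3 i4 p1 p2 p3 p4 i3 = truncated_pref p3"
  "profile4 i1 i2 i3 i4 p1 p2 p3 p4 i4 = truncated_pref p4"
  by (simp_all add: profile4_def)

lemma profile4_upd:
  "(profile4 i1 i2 i3 i4 p1 p2 p3 p4)(i1 := truncated_pref q) = profile4 i1 i2 i3 i4 q p2 p3 p4"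
  "(profile4 i1 i2 i3 i4 p1 p2 p3 p4)(i2 := truncated_pref q) = profile4 i1 i2 i3 i4 p1 q p3 p4"
  "(profile4 i1 i2 i3 i4 p1 p2 p3 p4)(i3 := truncated_pref q) = profile4 i1 i2 i3 i4 p1 p2 q p4"
  "(profile4 i1 i2 i3 i4 p1 p2 p3 p4)(i4 := truncated_pref q) = profile4 i1 i2 i3 i4 p1 p2 p3 q"
  by (simp_all add: profile4_def fun_eq_iff)

text \<open>Case of a one-element prefix: the share of the top object does not depend on what
  follows it.\<close>

lemma share_eq_top:
  assumes "distinct (x # ys)" "distinct (x # zs)"
  shows "S i1 (x # ys) p2 p3 p4 x = S i1 (x # zs) p2 p3 p4 x"
    and "S i2 p1 (x # ys) p3 p4 x = S i2 p1 (x # zs) p3 p4 x"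
    and "S i3 p1 p2 (x # ys) p4 x = S i3 p1 p2 (x # zs) p4 x"
    and "S i4 p1 p2 p3 (x # ys) x = S i4 p1 p2 p3 (x # zs) x"
  using share_upper_set_eq[OF profile4_profiles, of "x # ys" p2 p3 p4 i1 "[x]" ys "[x]" zs]
    share_upper_set_eq[OF profile4_profiles, of p1 "x # ys" p3 p4 i2 "[x]" ys "[x]" zs]
    share_upper_set_eq[OF profile4_profiles, of p1 p2 "x # ys" p4 i3 "[x]" ys "[x]" zs]
    share_upper_set_eq[OF profile4_profiles, of p1 p2 p3 "x # ys" i4 "[x]" ys "[x]" zs] assms
  unfolding S_def profile4_upd profile4_apply by simp_all

text \<open>Case of a two-element prefix that is the whole acceptable list: only the sum of the two
  shares is preserved.\<close>

lemma share_eq_swap: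
  assumes "x \<noteq> y"
  shows "S i1 [x, y] p2 p3 p4 x + S i1 [x, y] p2 p3 p4 y =
      S i1 [y, x] p2 p3 p4 x + S i1 [y, x] p2 p3 p4 y"
    and "S i2 p1 [x, y] p3 p4 x + S i2 p1 [x, y] p3 p4 y =
      S i2 p1 [y, x] p3 p4 x + S i2 p1 [y, x] p3 p4 y"
  using share_upper_set_eq[OF profile4_profiles,
      of "[x, y]" p2 p3 p4 i1 "[x, y]" "[]" "[y, x]" "[]"]
    share_upper_set_eq[OF profile4_profiles,
      of p1 "[x, y]" p3 p4 i2 "[x, y]" "[]" "[y, x]" "[]"] assms
  unfolding S_def profile4_upd profile4_apply by (simp_all add: insert_commute)

lemma share_equals:
  "S i1 p p p3 p4 x = S i2 p p p3 p4 x"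
  "S i1 p p2 p p4 x = S i3 p p2 p p4 x"
  "S i2 p1 p p3 p x = S i4 p1 p p3 p x"
  using equals profile4_profiles
  unfolding equal_treatment_of_equals_def S_def by (metis profile4_upd fun_upd_same)+

lemma share_zero:
  "x \<notin> set p1 \<Longrightarrow> S i1 p1 p2 p3 p4 x = 0"
  "x \<notin> set p2 \<Longrightarrow> S i2 p1 p2 p3 p4 x = 0"
  "x \<notin> set p3 \<Longrightarrow> S i3 p1 p2 p3 p4 x = 0"
  "x \<notin> set p4 \<Longrightarrow> S i4 p1 p2 p3 p4 x = 0"
  "i \<notin> {i1, i2, i3, i4} \<Longrightarrow> S i p1 p2 p3 p4 x = 0"
  using share_unacceptable[OF non_wasteful profile4_profiles]
  by (auto simp: S_def profile4_def acceptable_truncated_pref)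

lemma share_nonneg: "S i p1 p2 p3 p4 x \<ge> 0"
  by (simp add: S_def share_def)

lemma share_le_1: "x \<noteq> y \<Longrightarrow> S i p1 p2 p3 p4 x + S i p1 p2 p3 p4 y \<le> 1"
  using sum_share_eq_prob[of f "profile4 i1 i2 i3 i4 p1 p2 p3 p4" i "{Some x, Some y}"]
  by (simp add: S_def)

lemma sum_agents:
  "(\<Sum>i\<in>UNIV. S i p1 p2 p3 p4 x) =
     S i1 p1 p2 p3 p4 x + S i2 p1 p2 p3 p4 x + S i3 p1 p2 p3 p4 x + S i4 p1 p2 p3 p4 x"
proof -
  have "(\<Sum>i\<in>UNIV. S i p1 p2 p3 p4 x) = (\<Sum>i\<in>{i1, i2, i3, i4}. S i p1 p2 p3 p4 x)"
    by (rule sum.mono_neutral_right) (auto intro: share_zero(5))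
  then show ?thesis by simp
qed

text \<open>The agents outside the four accept nothing, so an object that is handed out in full by
  the pigeonhole argument is divided among the four. The set \<open>K\<close> names the agents used
  in that argument.\<close>

lemma assigned:
  fixes p1 p2 p3 p4
  defines "P \<equiv> (\<lambda>_. [])(i1 := p1, i2 := p2, i3 := p3, i4 := p4)"
  assumes "\<forall>k\<in>K. x \<in> set (P k)" and "card ((\<Union>k\<in>K. set (P k)) - {x}) < card K"
  shows "S i1 p1 p2 p3 p4 x + S i2 p1 p2 p3 p4 x + S i3 p1 p2 p3 p4 x + S i4 p1 p2 p3 p4 x = 1"
proof -
  have "acceptable (profile4 i1 i2 i3 i4 p1 p2 p3 p4 k) = set (P k)" for k
    by (simp add: profile4_def acceptable_truncated_pref P_def)
  then have "(\<Sum>i\<in>UNIV. S i p1 p2 p3 p4 x) = 1"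
    unfolding S_def using assms(2,3)
    by (intro sum_share_pigeonhole[OF mechanism non_wasteful profile4_profiles, of K]) auto
  then show ?thesis by (simp add: sum_agents)
qed

lemmas assigned1 = assigned[where K = "{i1}", simplified]
lemmas assigned2 = assigned[where K = "{i2}", simplified]
lemmas assigned3 = assigned[where K = "{i3}", simplified]
lemmas assigned4 = assigned[where K = "{i4}", simplified]
lemmas assigned12 = assigned[where K = "{i1, i2}", simplified]
lemmas assigned13 = assigned[where K = "{i1, i3}", simplified]
lemmas assigned24 = assigned[where K = "{i2, i4}", simplified]
lemmas assigned124 = assigned[where K = "{i1, i2, i4}", simplified]
lemmas assigned1234 = assigned[where K = "{i1, i2, i3, i4}", simplified]

text \<open>Only \<open>i4\<close> accepts \<open>b\<close>, hence gets it for sure under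
  \<open>[b]\<close>, and also under \<open>[b, c]\<close> because the share of a top object is
  preserved. Nothing is left for \<open>c\<close>.\<close>

lemma share_first_choice:
  assumes "b \<notin> set p1" "b \<notin> set p2" "b \<notin> set p3" "q \<in> {[b], [b, c]}"
  shows "S i4 p1 p2 p3 q b = 1" "S i4 p1 p2 p3 q c = 0"
proof -
  have "S i4 p1 p2 p3 [b] b = 1"
    using assigned4[of b "[b]" p1 p2 p3] assms by (simp add: share_zero)
  moreover have "S i4 p1 p2 p3 q b = S i4 p1 p2 p3 [b] b"
    using assms(4) share_eq_top(4)[of b "[c]" "[]"] by auto
  ultimately show 1: "S i4 p1 p2 p3 q b = 1" by simp
  show "S i4 p1 p2 p3 q c = 0"
    using 1 share_le_1[of b c i4 p1 p2 p3 q] share_nonneg[of i4 p1 p2 p3 q c] by simp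
qed

lemma share_ac_ca_a:
  assumes q: "q \<in> {[b], [b, c]}"
  shows "S i2 [a,c] [c,a] [a] q c = 5/6 - S i2 [a,c] [c,a] [a,c] q a / 2"
proof -
  have [simp]: "a \<notin> set q" using q by auto
  note [simp] = share_zero share_first_choice(2)[OF _ _ _ q]
  \<comment> \<open>Three equal agents divide \<open>a\<close>; truncating the list of
    \<open>i3\<close> preserves its third, so \<open>i1\<close> and \<open>i2\<close> keep theirs as
    well.\<close>
  have "S i1 [a,c] [a,c] [a,c] q a = 1/3"
    using assigned12[of a "[a,c]" "[a,c]" "[a,c]" q] share_equals(1)[of "[a,c]" "[a,c]" q a]
      share_equals(2)[of "[a,c]" "[a,c]" q a]
    by (simp add: insert_Diff_if)
  then have "S i3 [a,c] [a,c] [a] q a = 1/3"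
    using share_equals(2)[of "[a,c]" "[a,c]" q a] share_eq_top(3)[of a "[c]" "[]" "[a,c]" "[a,c]" q]
    by simp
  then have "S i2 [a,c] [a,c] [a] q a = 1/3"
    using assigned12[of a "[a,c]" "[a,c]" "[a]" q] share_equals(1)[of "[a,c]" "[a]" q a]
    by (simp add: insert_Diff_if)
  moreover have "S i2 [a,c] [a,c] [a] q c = 1/2"
    using assigned12[of c "[a,c]" "[a,c]" "[a]" q] share_equals(1)[of "[a,c]" "[a]" q c]
    by (simp add: insert_Diff_if)
  \<comment> \<open>The total is 1/3 from \<open>a\<close> plus 1/2 from \<open>c\<close>, and
    swapping the two objects preserves it. What remains is to find the share of
    \<open>a\<close>.\<close>
  ultimately have 1: "S i2 [a,c] [c,a] [a] q a + S i2 [a,c] [c,a] [a] q c = 5/6"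
    using share_eq_swap(2)[of a c "[a,c]" "[a]" q] by simp
  \<comment> \<open>Once \<open>i1\<close> drops \<open>c\<close>, \<open>i2\<close> surely gets it,
    and \<open>i1\<close> and \<open>i3\<close> halve \<open>a\<close>. Restoring \<open>c\<close>
    at the end of the list of \<open>i1\<close> preserves this half.\<close>
  have "S i2 [a] [c,a] [a] q c = 1"
    using share_eq_top(2)[of c "[a]" "[]" "[a]" "[a]" q] assigned2[of c "[c]" "[a]" "[a]" q] by simp
  then have "S i2 [a] [c,a] [a] q a = 0"
    using share_le_1[of a c i2 "[a]" "[c,a]" "[a]" q] share_nonneg[of i2 "[a]" "[c,a]" "[a]" q a] by simp
  then have "S i1 [a,c] [c,a] [a] q a = 1/2"
    using assigned1[of a "[a]" "[c,a]" "[a]" q] share_equals(2)[of "[a]" "[c,a]" q a]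
      share_eq_top(1)[of a "[c]" "[]" "[c,a]" "[a]" q] by simp
  \<comment> \<open>Extending the list of \<open>i3\<close> to \<open>[a,c]\<close> makes it equal
    to \<open>i1\<close>; they halve what \<open>i2\<close> leaves of \<open>a\<close>.\<close>
  moreover have "S i3 [a,c] [c,a] [a] q a = (1 - S i2 [a,c] [c,a] [a,c] q a) / 2"
    using assigned13[of a "[a,c]" "[a,c]" "[c,a]" q] share_equals(2)[of "[a,c]" "[c,a]" q a]
      share_eq_top(3)[of a "[c]" "[]" "[a,c]" "[c,a]" q] by (simp add: insert_Diff_if)
  ultimately show ?thesis
    using 1 assigned3[of a "[a]" "[a,c]" "[c,a]" q] by simp
qed

text \<open>Agent \<open>i3\<close> takes \<open>a\<close>, so with lists \<open>[b,c]\<close> the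
  other three divide \<open>b\<close> and \<open>c\<close> equally; swapping the list of
  \<open>i1\<close> preserves its total of 2/3.\<close>

lemma share_cb_bc_bc:
  assumes q: "q \<in> {[a], [a, c]}"
  shows "S i1 [c,b] [b,c] q [b,c] c = 2/3 - S i1 [c,b] [b,c] q [b,c] b"
proof -
  have [simp]: "b \<notin> set q" using q by auto
  note [simp] = share_zero
  have "S i3 [b,c] [b,c] [a] [b,c] a = 1" using assigned3[of a "[a]" "[b,c]" "[b,c]" "[b,c]"] by simp
  then have "S i3 [b,c] [b,c] q [b,c] a = 1" 
    using q share_eq_top(3)[of a "[c]" "[]" "[b,c]" "[b,c]" "[b,c]"] by auto
  then have "S i3 [b,c] [b,c] q [b,c] c = 0"
    using share_le_1[of a c i3 "[b,c]" "[b,c]" q "[b,c]"] share_nonneg[of i3 "[b,c]" "[b,c]" q "[b,c]" c]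
    by simp
  then have third: "S i1 [b,c] [b,c] q [b,c] x = 1/3" if "x \<in> {b, c}" for x
    using that assigned124[of x "[b,c]" "[b,c]" "[b,c]" q] share_equals(1)[of "[b,c]" q "[b,c]" x]
      share_equals(3)[of "[b,c]" "[b,c]" q x]
    by (auto simp: insert_Diff_if)
  show ?thesis
    using third[of b] third[of c] share_eq_swap(1)[of b c "[b,c]" q "[b,c]"] by simp
qed

text \<open>
  The right-hand side changes sign under the symmetry swapping \<open>i1\<close> with \<open>i2\<close>, \<open>i3\<close> with \<open>i4\<close> and \<open>a\<close> with
  \<open>b\<close>, up to its first term; the profile on the left-hand side is invariant. Adding the two instances
  therefore leaves only the shares of \<open>i1\<close> and \<open>i2\<close> in \<open>c\<close>, which sum to one half.
\<close>

lemma unassigned_share_i2: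
  "2 * (1 - S i2 [a,c] [b,c] [a] [b] b - S i2 [a,c] [b,c] [a] [b] c) =
     S i1 [a,c] [b,c] [a,c] [b,c] c
     + S i2 [a,c] [c,a] [a,c] [b] a - S i2 [a,c] [c,a] [a,c] [b,c] a
     - S i1 [c,b] [b,c] [a] [b,c] b + S i1 [c,b] [b,c] [a,c] [b,c] b"
proof -
  note [simp] = share_zero
  have cb: "S i2 [a,c] [c,b] [a] q c = 5/6 - S i2 [a,c] [c,a] [a,c] q a / 2" if "q \<in> {[b], [b, c]}" for q
    using share_eq_top(2)[of c "[a]" "[b]" "[a,c]" "[a]" q] share_ac_ca_a[OF that] by simp
  \<comment> \<open>Only \<open>i2\<close> and \<open>i4\<close> divide \<open>b\<close>, and
    extending \<open>[b]\<close> to \<open>[b,c]\<close> preserves the share of \<open>i4\<close>.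
    This equality links the swap equations of \<open>i2\<close> for the two lists of
    \<open>i4\<close>.\<close>
  have "S i2 [a,c] [c,b] [a] [b] b = S i2 [a,c] [c,b] [a] [b,c] b"
    using assigned4[of b "[b]" "[a,c]" "[c,b]" "[a]"] assigned24[of b "[c,b]" "[b,c]" "[a,c]" "[a]"]
      share_eq_top(4)[of b "[]" "[c]" "[a,c]" "[c,b]" "[a]"] by (simp add: insert_Diff_if)
  moreover have "S i2 [a,c] [b,c] [a] [b,c] b = 1/2"
    using assigned24[of b "[b,c]" "[b,c]" "[a,c]" "[a]"] share_equals(3)[of "[a,c]" "[b,c]" "[a]" b]
    by (simp add: insert_Diff_if)
  ultimately have s: "1 - S i2 [a,c] [b,c] [a] [b] b - S i2 [a,c] [b,c] [a] [b] c =
      1/2 + S i2 [a,c] [c,a] [a,c] [b] a / 2 - S i2 [a,c] [c,a] [a,c] [b,c] a / 2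
       - S i2 [a,c] [b,c] [a] [b,c] c"
    using cb[of "[b]"] cb[of "[b,c]"] share_eq_swap(2)[of b c "[a,c]" "[a]" "[b]"]
      share_eq_swap(2)[of b c "[a,c]" "[a]" "[b,c]"] by simp
  have ca: "S i1 [c,a] [b,c] q [b,c] c = 2/3 - S i1 [c,b] [b,c] q [b,c] b" if "q \<in> {[a], [a, c]}" for q
    using share_eq_top(1)[of c "[a]" "[b]" "[b,c]" q "[b,c]"] share_cb_bc_bc[OF that] by simp
  have "S i1 [a,c] [b,c] [a] [b,c] a = 1/2"
    using assigned1[of a "[a]" "[b,c]" "[a]" "[b,c]"] share_equals(2)[of "[a]" "[b,c]" "[b,c]" a]
      share_eq_top(1)[of a "[c]" "[]" "[b,c]" "[a]" "[b,c]"] by simp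
  moreover have "S i1 [a,c] [b,c] [a] [b,c] c = 1 - 2 * S i2 [a,c] [b,c] [a] [b,c] c"
    using assigned124[of c "[a,c]" "[b,c]" "[b,c]" "[a]"] share_equals(3)[of "[a,c]" "[b,c]" "[a]" c]
    by (simp add: insert_Diff_if)
  \<comment> \<open>The same device for \<open>i1\<close>: its rival for \<open>a\<close> is
    \<open>i3\<close>, whose share of \<open>a\<close> survives the extension to
    \<open>[a,c]\<close>.\<close>
  moreover have "S i1 [c,a] [b,c] [a] [b,c] a = S i1 [c,a] [b,c] [a,c] [b,c] a"
    using assigned3[of a "[a]" "[c,a]" "[b,c]" "[b,c]"] assigned13[of a "[c,a]" "[a,c]" "[b,c]" "[b,c]"]
      share_eq_top(3)[of a "[]" "[c]" "[c,a]" "[b,c]" "[b,c]"] by (simp add: insert_Diff_if)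
  moreover have "S i1 [a,c] [b,c] [a,c] [b,c] a = 1/2"
    using assigned13[of a "[a,c]" "[a,c]" "[b,c]" "[b,c]"] share_equals(2)[of "[a,c]" "[b,c]" "[b,c]" a]
    by (simp add: insert_Diff_if)
  ultimately have "2 * S i2 [a,c] [b,c] [a] [b,c] c =
      1 + S i1 [c,b] [b,c] [a] [b,c] b - S i1 [a,c] [b,c] [a,c] [b,c] c - S i1 [c,b] [b,c] [a,c] [b,c] b"
    using ca[of "[a]"] ca[of "[a,c]"] share_eq_swap(1)[of a c "[b,c]" "[a]" "[b,c]"]
      share_eq_swap(1)[of a c "[b,c]" "[a,c]" "[b,c]"] by simp
  with s show ?thesis by simp
qed

end

section \<open>Assembly of the lower bound\<close>

lemma ex_distinct_list_of_length:
  assumes "n \<le> CARD('a::finite)"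
  shows "\<exists>xs :: 'a list. distinct xs \<and> length xs = n"
proof -
  obtain A :: "'a set" where "card A = n" "finite A"
    using obtain_subset_with_card_n[OF assms] by blast
  then show ?thesis using finite_distinct_list[of A] distinct_card by metis
qed

theorem (in fair_mechanism) object_wasteful_quarter:
  assumes "CARD('i) \<ge> 4" "CARD('o) \<ge> 3"
  shows "object_wasteful (1/4) f"
proof -
  obtain js :: "'i list" where js: "distinct js" "length js = 4"
    using ex_distinct_list_of_length[OF assms(1)] by blast
  then obtain i1 i2 i3 i4 where "js = [i1, i2, i3, i4]"
    by (auto simp: numeral_eq_Suc length_Suc_conv)
  with js have agents: "distinct [i1, i2, i3, i4]" by simp
  obtain xs :: "'o list" where xs: "distinct xs" "length xs = 3"
    using ex_distinct_list_of_length[OF assms(2)] by blast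
  then obtain a b c where "xs = [a, b, c]"
    by (auto simp: numeral_eq_Suc length_Suc_conv)
  with xs have objects: "distinct [a, b, c]" by simp
  interpret P: four_agents f i1 i2 i3 i4 a b c
    using agents objects by unfold_locales
  \<comment> \<open>The mirror image of the first interpretation: its identities concern the same
    profiles with the roles of the agents and of \<open>a\<close> and \<open>b\<close>
    exchanged.\<close>
  interpret Q: four_agents f i2 i1 i4 i3 b a c
    using agents objects by unfold_locales auto
  define R where "R = profile4 i1 i2 i3 i4 [a,c] [b,c] [a] [b]"
  have R: "R \<in> profiles" unfolding R_def by (rule P.profile4_profiles)
  have Q_eq: "Q.S i p2 p1 p4 p3 x = P.S i p1 p2 p3 p4 x" for i p1 p2 p3 p4 x
    unfolding P.S_def Q.S_def profile4_def
    by (rule arg_cong[where f = "\<lambda>R. share f R i (Some x)"]) (auto simp: fun_eq_iff)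
  have S: "P.S i [a,c] [b,c] [a] [b] x = share f R i (Some x)" for i x
    by (simp add: P.S_def R_def)
  let ?s = "1 - share f R i2 (Some b) - share f R i2 (Some c)"
    and ?t = "1 - share f R i1 (Some a) - share f R i1 (Some c)"
  \<comment> \<open>All four agents accept \<open>c\<close>, and only \<open>a\<close> and
    \<open>b\<close> besides, so \<open>c\<close> is handed out in full; equal treatment within the
    pairs \<open>i1\<close>, \<open>i3\<close> and \<open>i2\<close>, \<open>i4\<close> gives one
    half.\<close>
  have "card {b, a, b, a} < 4" by (simp add: card_insert_if)
  then have "P.S i1 [a,c] [b,c] [a,c] [b,c] c + P.S i2 [a,c] [b,c] [a,c] [b,c] c = 1/2"
    using P.assigned1234[of c "[a,c]" "[b,c]" "[a,c]" "[b,c]"]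
      P.share_equals(2)[of "[a,c]" "[b,c]" "[b,c]" c] P.share_equals(3)[of "[a,c]" "[b,c]" "[a,c]" c]
    by (simp add: insert_Diff_if)
  then have st: "?s + ?t = 1/4"
    using P.unassigned_share_i2 Q.unassigned_share_i2 unfolding Q_eq S by simp
  have acc: "acceptable (R i1) = {a, c}" "acceptable (R i2) = {b, c}"
      "acceptable (R i3) = {a}" "acceptable (R i4) = {b}"
    by (simp_all add: R_def P.profile4_apply acceptable_truncated_pref)
  have None: "share f R i1 None = ?t" "share f R i2 None = ?s"
    using share_None[OF non_wasteful R] by (simp_all add: acc)
  have "share f R i1 (Some a) = P.S i1 [a] [b,c] [a] [b] a"
    using P.share_eq_top(1)[of a "[c]" "[]" "[b,c]" "[a]" "[b]"] by (simp add: S)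
  also have "\<dots> = 1/2"
    using P.assigned1[of a "[a]" "[b,c]" "[a]" "[b]"] P.share_equals(2)[of "[a]" "[b,c]" "[b]" a]
    by (simp add: P.share_zero)
  finally have a: "share f R i1 (Some a) = 1/2" .
  have "share f R i2 (Some b) = P.S i2 [a,c] [b] [a] [b] b"
    using P.share_eq_top(2)[of b "[c]" "[]" "[a,c]" "[a]" "[b]"] by (simp add: S)
  also have "\<dots> = 1/2"
    using P.assigned2[of b "[b]" "[a,c]" "[a]" "[b]"] P.share_equals(3)[of "[a,c]" "[b]" "[a]" b]
    by (simp add: P.share_zero)
  finally have b: "share f R i2 (Some b) = 1/2" .
  have "{i. strictly_prefers (R i) (Some c) None} = {i. c \<in> acceptable (R i)}"
    by (simp add: acceptable_def)
  also have "\<dots> = {i1, i2}"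
  proof (rule set_eqI)
    fix i
    show "i \<in> {i. c \<in> acceptable (R i)} \<longleftrightarrow> i \<in> {i1, i2}"
      by (simp add: R_def profile4_def acceptable_truncated_pref)
  qed
  finally have "(\<Sum>i | strictly_prefers (R i) (Some c) None. share f R i None) = 1/4"
    using st None by simp
  \<comment> \<open>As \<open>i1\<close> and \<open>i2\<close> each get half of their top object,
    \<open>?s + ?t\<close> equals one minus their shares of \<open>c\<close>.\<close>
  moreover have "unassigned_share f R c = 1/4"
    using P.sum_agents[of "[a,c]" "[b,c]" "[a]" "[b]" c] a b st
    unfolding unassigned_share_def
    by (simp flip: S add: P.share_zero)
  ultimately show ?thesis
    unfolding object_wasteful_def using R by (intro conjI bexI[of _ R] exI[of _ c]) auto
qed


section \<open>Serial dictatorships\<close>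

fun precedes :: "'a list \<Rightarrow> 'a \<Rightarrow> 'a \<Rightarrow> bool" where
  "precedes [] x y \<longleftrightarrow> False"
| "precedes (z # zs) x y \<longleftrightarrow> (if z = x then y \<in> set zs else precedes zs x y)"

lemma precedes_in_set: "precedes xs x y \<Longrightarrow> x \<in> set xs \<and> y \<in> set xs"
  by (induction xs) (auto split: if_splits)

lemma precedes_total: "x \<in> set xs \<Longrightarrow> y \<in> set xs \<Longrightarrow> x \<noteq> y \<Longrightarrow> precedes xs x y \<or> precedes xs y x"
  by (induction xs) auto

lemma precedes_asym: "distinct xs \<Longrightarrow> precedes xs x y \<Longrightarrow> \<not> precedes xs y x"
  by (induction xs) (auto split: if_splits dest: precedes_in_set)

lemma precedes_trans: "distinct xs \<Longrightarrow> precedes xs x y \<Longrightarrow> precedes xs y z \<Longrightarrow> precedes xs x z"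
  by (induction xs) (auto split: if_splits dest: precedes_in_set)

lemma precedes_map: "inj h \<Longrightarrow> precedes (map h xs) (h x) (h y) \<longleftrightarrow> precedes xs x y"
  by (induction xs) (auto simp: inj_eq inj_image_mem_iff)

section \<open>Properties of a single serial dictatorship\<close>

lemma serial_dictatorship_head:
  "serial_dictatorship (i # is) R X i = favourite (R i) (insert None (Some ` X))"
  by (simp add: Let_def)

lemma serial_dictatorship_tail:
  "j \<noteq> i \<Longrightarrow> serial_dictatorship (i # is) R X j =
     serial_dictatorship is R {x \<in> X. Some x \<noteq> favourite (R i) (insert None (Some ` X))} j"
  by (simp add: Let_def)

declare serial_dictatorship.simps(2) [simp del]

context
  fixes R :: "('i, 'o::finite) profile"
  assumes R: "R \<in> profiles"
begin

lemma serial_dictatorship_available: "serial_dictatorship is R X i = Some x \<Longrightarrow> x \<in> X"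
proof (induction "is" arbitrary: X)
  case (Cons j js)
  then show ?case
    using favourite_in[OF profilesD[OF R], of "insert None (Some ` X)" j]
    by (cases "i = j") (auto simp: serial_dictatorship_head serial_dictatorship_tail)
qed simp

lemma serial_dictatorship_assignments: "serial_dictatorship is R X \<in> assignments"
proof (induction "is" arbitrary: X)
  case (Cons k ks)
  let ?a = "favourite (R k) (insert None (Some ` X))"
  let ?D = "serial_dictatorship ks R {x \<in> X. Some x \<noteq> ?a}"
  have "?D j \<noteq> ?a" if "?a = Some x" for j x
    using that serial_dictatorship_available[of ks "{x \<in> X. Some x \<noteq> ?a}" j x] by auto
  then have "?D(k := ?a) \<in> assignments"
    using Cons.IH[of "{x \<in> X. Some x \<noteq> ?a}"] unfolding assignments_def
    by (auto split: if_splits)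
  then show ?case by (simp only: serial_dictatorship.simps Let_def)
qed (simp add: assignments_def)

lemma serial_dictatorship_individually_rational: "(serial_dictatorship is R X i, None) \<in> R i"
proof (induction "is" arbitrary: X)
  case (Cons k ks)
  then show ?case
    using favourite_best[OF profilesD[OF R], of "insert None (Some ` X)" None]
    by (cases "i = k") (auto simp: serial_dictatorship_head serial_dictatorship_tail)
qed (simp add: pref_refl[OF profilesD[OF R]])

text \<open>The first agent already receives his favourite, so a weakly improving
  \<open>\<mu>\<close> must agree with it; the remaining agents then face the same reduced set of
  objects.\<close>

lemma serial_dictatorship_undominated:
  assumes "\<mu> \<in> assignments" "distinct is"
    and "\<And>i. i \<in> set is \<Longrightarrow> (\<mu> i, serial_dictatorship is R X i) \<in> R i"
    and "\<And>i. i \<in> set is \<Longrightarrow> \<mu> i \<in> insert None (Some ` X)" and "i \<in> set is"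
  shows "\<mu> i = serial_dictatorship is R X i"
  using assms(2-)
proof (induction "is" arbitrary: X)
  case (Cons k ks)
  let ?A = "insert None (Some ` X)"
  let ?X = "{x \<in> X. Some x \<noteq> favourite (R k) ?A}"
  have k: "\<mu> k = favourite (R k) ?A"
    using Cons.prems(2,3)[of k] favourite_best[OF profilesD[OF R], of ?A "\<mu> k" k]
      pref_antisym[OF profilesD[OF R]]
    by (auto simp: serial_dictatorship_head)
  show ?case
  proof (cases "i = k")
    case False
    have "\<mu> i = serial_dictatorship ks R ?X i"
    proof (rule Cons.IH)
      fix j assume j: "j \<in> set ks"
      with Cons.prems(1) have "j \<noteq> k" by auto
      then show "(\<mu> j, serial_dictatorship ks R ?X j) \<in> R j"
        using Cons.prems(2)[of j] j by (simp add: serial_dictatorship_tail)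
      have "\<mu> j \<noteq> \<mu> k" if "\<mu> j = Some x" for x
        using that \<open>j \<noteq> k\<close> assms(1) unfolding assignments_def by (metis (mono_tags, lifting) mem_Collect_eq)
      then show "\<mu> j \<in> insert None (Some ` ?X)"
        using Cons.prems(3)[of j] j k by auto
    qed (use Cons.prems False in auto)
    then show ?thesis using False by (simp add: serial_dictatorship_tail)
  qed (simp add: k serial_dictatorship_head)
qed simp

lemma serial_dictatorship_efficient:
  assumes "is \<in> permutations_of_set UNIV"
  shows "efficient R (serial_dictatorship is R UNIV)"
proof -
  have "set is = UNIV" "distinct is" using assms by (auto simp: permutations_of_set_def)
  moreover have "\<mu> i \<in> insert None (Some ` UNIV)" for \<mu> :: "('i, 'o) assignment" and i
    by (cases "\<mu> i") auto
  ultimately have "\<mu> i = serial_dictatorship is R UNIV i"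
    if "\<mu> \<in> assignments" "\<forall>i. (\<mu> i, serial_dictatorship is R UNIV i) \<in> R i" for \<mu> i
    using that serial_dictatorship_undominated[of \<mu> "is" UNIV i] by blast
  then show ?thesis unfolding efficient_def by (metis strictly_prefers_def)
qed

text \<open>The report of \<open>i\<close> does not influence earlier choices, hence not the menu of
  \<open>i\<close>; the truthful report picks the best option from it.\<close>

lemma serial_dictatorship_truthful:
  assumes "r \<in> prefs"
  shows "(serial_dictatorship is R X i, serial_dictatorship is (R(i := r)) X i) \<in> R i"
proof (induction "is" arbitrary: X)
  case (Cons k ks)
  then show ?case
    using favourite_best[OF profilesD[OF R], of "insert None (Some ` X)" "favourite r (insert None (Some ` X))" k]
      favourite_in[OF assms, of "insert None (Some ` X)"]
    by (cases "i = k") (auto simp: serial_dictatorship_head serial_dictatorship_tail)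
qed (simp add: pref_refl[OF profilesD[OF R]])

lemma favourite_almost_equal:
  assumes eq: "restrict_objects (R i) = restrict_objects (R j)"
    and card: "card (acceptable (R i)) \<le> card (acceptable (R j))"
    and ne: "favourite (R i) (insert None (Some ` X)) \<noteq> favourite (R j) (insert None (Some ` X))"
  shows "acceptable (R i) \<inter> X = {}"
proof (rule ccontr)
  let ?A = "insert None (Some ` X)"
  note prefs = profilesD[OF R]
  \<comment> \<open>Both sets are upper sets of the same ranking of objects, hence nested, and the
    cardinalities fix the direction.\<close>
  have sub: "acceptable (R i) \<subseteq> acceptable (R j)"
  proof (rule ccontr)
    assume "\<not> ?thesis"
    then obtain z where z: "z \<in> acceptable (R i)" "z \<notin> acceptable (R j)" by blast
    have "w \<in> acceptable (R i)" if "w \<in> acceptable (R j)" for w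
    proof -
      have "(Some w, Some z) \<in> R j"
        using that z(2) pref_trans[OF prefs] pref_total[OF prefs]
        unfolding acceptable_iff[OF prefs] by metis
      then have "(Some w, Some z) \<in> R i" using eq unfolding restrict_objects_def by blast
      then show ?thesis using z(1) pref_trans[OF prefs] unfolding acceptable_iff[OF prefs] by metis
    qed
    with z have "acceptable (R j) \<subset> acceptable (R i)" by blast
    then show False using card psubset_card_mono[of "acceptable (R i)" "acceptable (R j)"] by simp
  qed
  assume "acceptable (R i) \<inter> X \<noteq> {}"
  then obtain y where y: "y \<in> acceptable (R i)" "y \<in> X" by blast
  have best: "favourite (R i) ?A \<in> ?A" "\<And>b. b \<in> ?A \<Longrightarrow> (favourite (R i) ?A, b) \<in> R i"
    by (rule favourite_in[OF prefs], simp_all, rule favourite_best[OF prefs], simp_all)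
  with y obtain z where z: "favourite (R i) ?A = Some z" "z \<in> X"
    using acceptable_iff[OF prefs] by fastforce
  have "(Some z, Some w) \<in> R i" if "w \<in> X" for w using best(2) z that by auto
  then have obj: "(Some z, Some w) \<in> R j" if "w \<in> X" for w
    using that eq unfolding restrict_objects_def by blast
  have "z \<in> acceptable (R i)"
    using best(2)[of "Some y"] y z pref_trans[OF prefs] unfolding acceptable_iff[OF prefs]
    by (metis imageI insertI2)
  then have "(Some z, None) \<in> R j" using sub pref_total[OF prefs] acceptable_iff[OF prefs] by blast
  then have "favourite (R j) ?A = Some z"
    using obj z(2) prefs by (intro favourite_eqI) auto
  with ne z show False by simp
qed

text \<open>While an acceptable object of \<open>i\<close> is available, \<open>i\<close> and
  \<open>j\<close> choose alike, so exchanging their positions exchanges their roles. Once none is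
  available, neither can obtain \<open>x\<close>.\<close>

lemma serial_dictatorship_transpose:
  assumes "restrict_objects (R i) = restrict_objects (R j)"
    and "card (acceptable (R i)) \<le> card (acceptable (R j))" and x: "x \<in> acceptable (R i)"
  shows "serial_dictatorship (map (Transposition.transpose i j) is) R X j = Some x \<longleftrightarrow>
         serial_dictatorship is R X i = Some x"
proof (cases "i = j")
  case False
  show ?thesis
  proof (induction "is" arbitrary: X)
    case (Cons k ks)
    let ?A = "insert None (Some ` X)"
    consider "favourite (R i) ?A = favourite (R j) ?A" | "x \<notin> X"
      using favourite_almost_equal[OF assms(1,2), of X] x by blast
    then show ?case
    proof cases
      case 1
      then show ?thesis
        using Cons.IH False
        by (cases "k = i"; cases "k = j")
          (auto simp: serial_dictatorship_head serial_dictatorship_tail)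
    next
      case 2
      then show ?thesis using serial_dictatorship_available by blast
    qed
  qed simp
qed simp

text \<open>Whatever \<open>l\<close> obtains later was still available when \<open>k\<close>
  chose.\<close>

lemma serial_dictatorship_no_envy:
  assumes "distinct is" "precedes is k l" "serial_dictatorship is R X l = Some x"
  shows "(serial_dictatorship is R X k, Some x) \<in> R k"
  using assms
proof (induction "is" arbitrary: X)
  case (Cons m ms)
  show ?case
  proof (cases "m = k")
    case True
    then show ?thesis
      using serial_dictatorship_available[OF Cons.prems(3)] favourite_best[OF profilesD[OF R]]
      by (simp add: serial_dictatorship_head)
  next
    case False
    moreover have "m \<noteq> l" using Cons.prems False precedes_in_set[of ms k l] by auto
    ultimately show ?thesis using Cons by (simp add: serial_dictatorship_tail)
  qed
qed simp

end

section \<open>The random order\<close>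

abbreviation (input) orders :: "'i::finite list pmf" where
  "orders \<equiv> pmf_of_set (permutations_of_set UNIV)"

lemma set_pmf_orders: "set_pmf (orders :: 'i::finite list pmf) = permutations_of_set UNIV"
  by (simp add: set_pmf_of_set)

text \<open>Relabelling the agents permutes the orders, so the uniform distribution is
  invariant.\<close>

lemma prob_order_map:
  fixes h :: "'i::finite \<Rightarrow> 'i"
  assumes "bij h"
  shows "measure_pmf.prob orders {is. Q (map h is)} = measure_pmf.prob orders {is. Q is}"
proof -
  have "map h ` permutations_of_set UNIV = permutations_of_set (h ` UNIV)"
    using assms by (intro permutations_of_set_image_inj[symmetric]) (auto simp: bij_def)
  then have "bij_betw (map h) (permutations_of_set UNIV) (permutations_of_set UNIV)"
    using assms by (auto simp: bij_betw_def bij_def intro: inj_on_mapI)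
  then have "map_pmf (map h) orders = (orders :: 'i list pmf)"
    by (intro map_pmf_of_set_bij_betw) auto
  then have "measure_pmf.prob orders {is. Q is} = measure_pmf.prob (map_pmf (map h) orders) {is. Q is}"
    by simp
  then show ?thesis by (simp add: vimage_def)
qed

lemma sum_prob_orders_le:
  fixes Q :: "'k \<Rightarrow> 'i::finite list \<Rightarrow> bool"
  assumes "finite K" "\<And>k l is. is \<in> permutations_of_set UNIV \<Longrightarrow> k \<in> K \<Longrightarrow> l \<in> K \<Longrightarrow> k \<noteq> l \<Longrightarrow> Q k is \<Longrightarrow> \<not> Q l is"
    and "\<And>k is. k \<in> K \<Longrightarrow> is \<in> permutations_of_set UNIV \<Longrightarrow> Q k is \<Longrightarrow> Q' is"
  shows "(\<Sum>k\<in>K. measure_pmf.prob orders {is. Q k is}) \<le> measure_pmf.prob orders {is. Q' is}"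
proof -
  let ?B = "\<lambda>k. {is \<in> permutations_of_set UNIV. Q k is}"
  have "(\<Sum>k\<in>K. measure_pmf.prob orders {is. Q k is}) = (\<Sum>k\<in>K. measure_pmf.prob orders (?B k))"
    by (intro sum.cong refl measure_pmf.finite_measure_eq_AE) (auto simp: AE_measure_pmf_iff)
  also have "\<dots> = measure_pmf.prob orders (\<Union>k\<in>K. ?B k)"
    using assms(1,2)
    by (intro measure_pmf.finite_measure_finite_Union[symmetric]) (auto simp: disjoint_family_on_def)
  also have "\<dots> \<le> measure_pmf.prob orders {is. Q' is}"
    using assms(3) by (intro measure_pmf.finite_measure_mono) auto
  finally show ?thesis .
qed

text \<open>The events that a given member of \<open>A\<close> comes first are mutually exclusive,
  and equally likely by transposing two members.\<close>

lemma prob_first_le: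
  fixes A :: "'i::finite set"
  assumes "i \<in> A"
  shows "card A * measure_pmf.prob orders {is. \<forall>k\<in>A - {i}. precedes is i k} \<le> 1"
proof -
  let ?F = "\<lambda>i is. \<forall>k\<in>A - {i}. precedes is i k"
  have eq: "measure_pmf.prob orders {is. ?F j is} = measure_pmf.prob orders {is. ?F i is}"
    if "j \<in> A" for j
  proof -
    let ?h = "Transposition.transpose i j"
    have "?h ` (A - {i}) = A - {j}"
      using that assms by (simp add: image_set_diff transpose_image_eq)
    then have "?F j (map ?h is) \<longleftrightarrow> (\<forall>k\<in>A - {i}. precedes (map ?h is) (?h i) (?h k))" for "is"
      by (metis (no_types, lifting) image_iff transpose_apply_first)
    then have "?F j (map ?h is) \<longleftrightarrow> ?F i is" for "is"
      by (simp only: precedes_map[OF inj_transpose])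
    then show ?thesis
      using prob_order_map[of ?h "?F j"] by simp
  qed
  have "(\<Sum>j\<in>A. measure_pmf.prob orders {is. ?F j is}) \<le> measure_pmf.prob orders {is :: 'i list. True}"
    by (rule sum_prob_orders_le)
      (auto simp: permutations_of_set_def dest: precedes_asym)
  then show ?thesis by (simp add: eq)
qed

text \<open>Transposing \<open>j\<close> and \<open>m\<close> leaves the event that \<open>i\<close>
  is first unchanged and exchanges the two relative orders of \<open>j\<close> and
  \<open>m\<close>.\<close>

lemma prob_first_second_le:
  fixes A :: "'i::finite set"
  assumes "i \<in> A" "j \<in> A - {i}" "m \<in> A - {i}" "j \<noteq> m"
  shows "2 * card A * measure_pmf.prob orders {is. (\<forall>k\<in>A - {i}. precedes is i k) \<and> precedes is j m} \<le> 1"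
proof -
  let ?F = "\<lambda>is. \<forall>k\<in>A - {i}. precedes is i k" and ?h = "Transposition.transpose j m"
  have im: "?h ` (A - {i}) = A - {i}" and "?h i = i"
    using assms by (auto simp: transpose_image_eq transpose_apply_other)
  then have "?F (map ?h is) \<longleftrightarrow> (\<forall>k\<in>A - {i}. precedes (map ?h is) (?h i) (?h k))" for "is"
    by (metis (no_types, lifting) image_iff)
  then have "?F (map ?h is) \<longleftrightarrow> ?F is" for "is"
    by (simp only: precedes_map[OF inj_transpose])
  moreover have "precedes (map ?h is) j m \<longleftrightarrow> precedes is m j" for "is"
    using precedes_map[OF inj_transpose, of j m "is" m j] by simp
  ultimately have "measure_pmf.prob orders {is. ?F is \<and> precedes is m j} =
      measure_pmf.prob orders {is. ?F is \<and> precedes is j m}"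
    using prob_order_map[of ?h "\<lambda>is. ?F is \<and> precedes is j m"] by simp
  moreover have "(\<Sum>b\<in>UNIV. measure_pmf.prob orders
      {is. ?F is \<and> (if b then precedes is j m else precedes is m j)}) \<le> measure_pmf.prob orders {is. ?F is}"
    by (rule sum_prob_orders_le) (auto simp: permutations_of_set_def dest: precedes_asym split: if_splits)
  ultimately have "2 * measure_pmf.prob orders {is. ?F is \<and> precedes is j m} \<le> measure_pmf.prob orders {is. ?F is}"
    by (simp add: UNIV_bool)
  then have "card A * (2 * measure_pmf.prob orders {is. ?F is \<and> precedes is j m})
      \<le> card A * measure_pmf.prob orders {is. ?F is}"
    by (intro mult_left_mono) auto
  with prob_first_le[OF assms(1)] show ?thesis by simp
qed


section \<open>Random serial dictatorship\<close>

lemma set_pmf_RSD: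
  "set_pmf (RSD R :: ('i::finite, 'o) assignment pmf) =
     (\<lambda>is. serial_dictatorship is R UNIV) ` permutations_of_set UNIV"
  by (simp add: RSD_def set_pmf_of_set)

lemma prob_RSD:
  "measure_pmf.prob (RSD R) {\<mu>. Q \<mu>} = measure_pmf.prob orders {is. Q (serial_dictatorship is R UNIV)}"
  by (simp add: RSD_def vimage_def)

lemma share_RSD:
  "share RSD R i a = measure_pmf.prob orders {is. serial_dictatorship is R UNIV i = a}"
  by (simp add: share_def prob_RSD)

lemma RSD_mechanism: "is_mechanism (RSD :: ('i::finite, 'o::finite) mechanism)"
  by (auto simp: is_mechanism_def set_pmf_RSD serial_dictatorship_assignments)

lemma RSD_ex_post_efficient: "ex_post_efficient (RSD :: ('i::finite, 'o::finite) mechanism)"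
  by (auto simp: ex_post_efficient_def set_pmf_RSD serial_dictatorship_efficient)

lemmas RSD_ex_post_weakly_non_wasteful =
  ex_post_efficient_imp_weakly_non_wasteful[OF RSD_mechanism RSD_ex_post_efficient]

lemma RSD_strategy_proof: "strategy_proof (RSD :: ('i::finite, 'o::finite) mechanism)"
  unfolding strategy_proof_def sum_share_eq_prob prob_RSD mem_Collect_eq
proof (intro ballI allI)
  fix R :: "('i, 'o) profile" and i a and r :: "'o pref"
  assume "R \<in> profiles" "r \<in> prefs"
  then show "measure_pmf.prob orders {is. (serial_dictatorship is (R(i := r)) UNIV i, a) \<in> R i}
      \<le> measure_pmf.prob orders {is. (serial_dictatorship is R UNIV i, a) \<in> R i}"
    using serial_dictatorship_truthful pref_trans[OF profilesD]
    by (intro measure_pmf.finite_measure_mono) fastforce+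
qed

lemma RSD_equal_treatment_of_almost_equals:
  "equal_treatment_of_almost_equals (RSD :: ('i::finite, 'o::finite) mechanism)"
  unfolding equal_treatment_of_almost_equals_def
proof (intro ballI allI impI, elim conjE)
  fix R :: "('i, 'o) profile" and i j x
  assume *: "R \<in> profiles" "x \<in> acceptable (R i)" "restrict_objects (R i) = restrict_objects (R j)"
    "card (acceptable (R i)) \<le> card (acceptable (R j))"
  then have "share RSD R i (Some x) = measure_pmf.prob orders
      {is. serial_dictatorship (map (Transposition.transpose i j) is) R UNIV j = Some x}"
    by (simp add: share_RSD serial_dictatorship_transpose)
  then show "share RSD R i (Some x) = share RSD R j (Some x)"
    by (simp add: share_RSD
        prob_order_map[where Q = "\<lambda>is. serial_dictatorship is R UNIV j = Some x"])
qed

lemmas RSD_equal_treatment_of_equals =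
  equal_treatment_of_almost_equals_imp_equals[OF RSD_ex_post_weakly_non_wasteful
    RSD_equal_treatment_of_almost_equals]

text \<open>The two sample orders reveal preferences: \<open>is1\<close> shows that \<open>i\<close>
  accepts \<open>a\<close> and that \<open>j\<close> prefers \<open>b\<close> to \<open>c\<close>,
  while \<open>is0\<close> supplies the competitors for \<open>a\<close> and
  \<open>b\<close>.\<close>

lemma prob_two_take_others_le:
  fixes R :: "('i::finite, 'o::finite) profile"
  assumes R: "R \<in> profiles" and ij: "i \<noteq> j" and abc: "UNIV = {a, b, c}" "distinct [a, b, c]"
    and acc: "{k. c \<in> acceptable (R k)} = {i, j}"
    and is0: "is0 \<in> permutations_of_set UNIV" "serial_dictatorship is0 R UNIV i = None"
    and is1: "is1 \<in> permutations_of_set UNIV" "\<And>k. serial_dictatorship is1 R UNIV k \<noteq> Some c"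
      "serial_dictatorship is1 R UNIV i = Some a" "serial_dictatorship is1 R UNIV j = Some b"
  shows "measure_pmf.prob orders {is. \<forall>k. serial_dictatorship is R UNIV k \<noteq> Some c} \<le> 1/4"
proof -
  define D where "D is = serial_dictatorship is R UNIV" for "is"
  note prefs = profilesD[OF R]
  have assignment: "k = l" if "D is k = Some x" "D is l = Some x" for "is" k l x
    using that serial_dictatorship_assignments[OF R, of "is" UNIV]
    unfolding D_def assignments_def by blast
  have ir: "x \<in> acceptable (R k)" if "D is k = Some x" for "is" k x
    using that serial_dictatorship_individually_rational[OF R, of "is" UNIV k]
      pref_antisym[OF prefs, of None "Some x" k]
    unfolding D_def acceptable_iff[OF prefs] by force
  have nw: "(D is k, Some x) \<in> R k"
    if "is \<in> permutations_of_set UNIV" "\<And>l. D is l \<noteq> Some x" for "is" k x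
    unfolding D_def
    using efficient_unassigned[OF R serial_dictatorship_assignments[OF R] serial_dictatorship_efficient[OF R that(1)]]
      that(2) unfolding D_def by blast
  have no_envy: "(D is k, Some x) \<in> R k"
    if "is \<in> permutations_of_set UNIV" "precedes is k l" "D is l = Some x" for "is" k l x
    using that serial_dictatorship_no_envy[OF R] unfolding D_def permutations_of_set_def by blast
  have dist: "a \<noteq> b" "a \<noteq> c" "b \<noteq> c" using abc(2) by auto
  have acc_ij: "c \<in> acceptable (R i)" "c \<in> acceptable (R j)" using acc by auto

  have "(None, Some c) \<notin> R i" using acc_ij acceptable_iff[OF prefs] by blast
  then obtain l where l: "D is0 l = Some c" using nw[OF is0(1), of c i] is0(2) by (auto simp: D_def)
  then have "l \<in> {i, j}" using ir acc by blast
  then have j0: "D is0 j = Some c" using l is0(2) by (auto simp: D_def)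
  \<comment> \<open>Under \<open>is0\<close> agent \<open>i\<close> is empty-handed though accepting
    \<open>a\<close>, so someone holds \<open>a\<close>. Likewise \<open>j\<close> holds
    \<open>c\<close> but prefers \<open>b\<close>, so someone holds \<open>b\<close>.\<close>
  obtain p where p: "D is0 p = Some a"
    using nw[OF is0(1), of a i] ir[of is1 i a] is1(3) is0(2) acceptable_iff[OF prefs]
    by (auto simp: D_def)
  have "(Some b, Some c) \<in> R j" using nw[OF is1(1), of c j] is1(2,4) by (auto simp: D_def)
  then have "(Some c, Some b) \<notin> R j" using pref_antisym[OF prefs] dist by blast
  then obtain q where q: "D is0 q = Some b" using nw[OF is0(1), of b j] j0 by auto
  have p': "p \<notin> {i, j}" "q \<notin> {i, j}" "p \<noteq> q"
    using p q j0 is0(2) dist by (auto simp: D_def)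
  have pq: "a \<in> acceptable (R p)" "b \<in> acceptable (R q)" using p q ir by blast+

  let ?A = "{i, j, p, q}"
  have card: "card ?A = 4" using ij p' by auto
  txt \<open>
    If \<open>c\<close> stays unassigned, then \<open>p\<close> and \<open>q\<close> end up empty-handed, so \<open>p\<close> comes after the agent
    receiving \<open>a\<close> and \<open>q\<close> after the agent receiving \<open>b\<close>. The first of \<open>i\<close>, \<open>j\<close> finds both \<open>a\<close> and \<open>b\<close>
    available, hence his preference decides which of the two he takes.
  \<close>
  have key: "precedes is k p \<and> precedes is l q \<and> (Some a, Some b) \<in> R k \<or>
      precedes is k q \<and> precedes is l p \<and> (Some b, Some a) \<in> R k"
    if E: "is \<in> permutations_of_set UNIV" "\<And>m. D is m \<noteq> Some c" and kl: "precedes is k l" "{k, l} = {i, j}"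
    for "is" k l
  proof -
    have total: "precedes is u v \<or> precedes is v u" if "u \<noteq> v" for u v
      using that E(1) precedes_total[of u "is" v] by (auto simp: permutations_of_set_def)
    have some: "D is u \<noteq> None" if "u \<in> {i, j}" for u
      using nw[OF E, of u] that acc_ij acceptable_iff[OF prefs] by (metis insert_iff singletonD)
    have ab: "D is u \<in> {Some a, Some b}" if "u \<in> {i, j}" for u
      using some[OF that] E(2)[of u] abc(1) by (cases "D is u") auto
    have ne: "D is k \<noteq> D is l"
      using assignment[of "is" k _ l] some ij kl(2) by (metis doubleton_eq_iff not_None_eq insertI1)
    have kl': "k \<in> {i, j}" "l \<in> {i, j}" using kl(2) by auto
    have others: "D is u = None" if "u \<notin> {i, j}" for u
    proof (rule ccontr)
      assume "D is u \<noteq> None"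
      then have "D is u \<in> {Some a, Some b}" using E(2)[of u] abc(1) by (cases "D is u") auto
      then have "D is u = D is k \<or> D is u = D is l" using ab[OF kl'(1)] ab[OF kl'(2)] ne by auto
      then show False using assignment some kl' that by (metis not_None_eq)
    qed
    have before: "precedes is u v" if "D is u = Some x" "x \<in> acceptable (R v)" "v \<notin> {i, j}" for u v x
      using total[of u v] no_envy[OF E(1), of v u x] others[OF that(3)] that acceptable_iff[OF prefs]
      by (metis option.distinct(1))
    have "D is k = Some a \<and> D is l = Some b \<or> D is k = Some b \<and> D is l = Some a"
      using ab[OF kl'(1)] ab[OF kl'(2)] ne by auto
    then show ?thesis
      using before pq p' no_envy[OF E(1) kl(1)] by metis
  qed
  \<comment> \<open>If \<open>k\<close> is the earlier of \<open>i\<close> and \<open>j\<close>, his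
    ranking of \<open>a\<close> and \<open>b\<close> fixes which object is left to the later one;
    \<open>m k\<close> is the competitor for that object.\<close>
  define m where "m k = (if (Some a, Some b) \<in> R k then q else p)" for k
  have m: "m k \<in> {p, q}" for k by (simp add: m_def)
  have first: "(\<forall>u\<in>?A - {k}. precedes is k u) \<and> precedes is l (m k)"
    if E: "is \<in> permutations_of_set UNIV" "\<And>m. D is m \<noteq> Some c" and kl: "precedes is k l" "{k, l} = {i, j}"
    for "is" k l
  proof -
    have "?A - {k} = {l, p, q}" using kl(2) p' ij by (auto simp: doubleton_eq_iff)
    moreover have "distinct is" using E(1) by (simp add: permutations_of_set_def)
    ultimately show ?thesis
      using key[OF that] kl(1) precedes_trans[of "is" k l] pref_antisym[OF prefs, of "Some a" "Some b"] dist
      by (auto simp: m_def)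
  qed
  let ?E = "\<lambda>k l. {is. (\<forall>u\<in>?A - {k}. precedes is k u) \<and> precedes is l (m k)}"
  have "measure_pmf.prob orders {is. \<forall>k. D is k \<noteq> Some c} \<le> measure_pmf.prob orders (?E i j \<union> ?E j i)"
  proof (rule measure_pmf.finite_measure_mono_AE)
    show "AE is in orders. is \<in> {is. \<forall>k. D is k \<noteq> Some c} \<longrightarrow> is \<in> ?E i j \<union> ?E j i"
    proof (rule AE_pmfI, rule impI)
      fix "is" :: "'i list" assume "is \<in> set_pmf orders" and E: "is \<in> {is. \<forall>k. D is k \<noteq> Some c}"
      then have perm: "is \<in> permutations_of_set UNIV" by (simp add: set_pmf_orders)
      then have "precedes is i j \<or> precedes is j i"
        using ij precedes_total[of i "is" j] by (auto simp: permutations_of_set_def)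
      then show "is \<in> ?E i j \<union> ?E j i"
        using first[OF perm, of i j] first[OF perm, of j i] E by blast
    qed
  qed simp
  also have "\<dots> \<le> measure_pmf.prob orders (?E i j) + measure_pmf.prob orders (?E j i)"
    by (rule measure_Un_le) auto
  \<comment> \<open>With \<open>card ?A = 4\<close>, each event has probability at most 1/(2 *
    4).\<close>
  also have "\<dots> \<le> 1/8 + 1/8"
    using prob_first_second_le[of i ?A j "m i"] prob_first_second_le[of j ?A i "m j"] card ij p' m[of i] m[of j]
    by (intro add_mono) auto
  finally show ?thesis by (simp add: D_def)
qed

lemma RSD_waste_le:
  fixes R :: "('i::finite, 'o::finite) profile"
  assumes R: "R \<in> profiles" and card3: "CARD('o) = 3"
  shows "min (\<Sum>i | strictly_prefers (R i) (Some c) None. share RSD R i None)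
     (unassigned_share RSD R c) \<le> 1/4"
proof (rule ccontr)
  assume "\<not> ?thesis"
  then have sum: "(\<Sum>i | c \<in> acceptable (R i). share RSD R i None) > 1/4"
    and un: "measure_pmf.prob orders {is. \<forall>k. serial_dictatorship is R UNIV k \<noteq> Some c} > 1/4"
    by (auto simp: acceptable_def unassigned_share_eq[OF RSD_mechanism R] prob_RSD)
  let ?K = "{i. c \<in> acceptable (R i)}"
  have positive: "\<exists>is\<in>permutations_of_set UNIV. Q is" if "measure_pmf.prob orders {is. Q is} > 0"
    for Q :: "'i list \<Rightarrow> bool"
  proof (rule ccontr)
    assume "\<not> ?thesis"
    then have "measure_pmf.prob orders {is. Q is} = 0"
      unfolding measure_pmf_zero_iff set_pmf_orders by blast
    with that show False by simp
  qed
  have wnw: "weakly_non_wasteful R (serial_dictatorship is R UNIV)"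
    if "is \<in> permutations_of_set UNIV" for "is"
    using that R serial_dictatorship_assignments[OF R] serial_dictatorship_efficient[OF R]
    by (intro efficient_weakly_non_wasteful) auto
  have "\<exists>i\<in>?K. share RSD R i None > 0"
  proof (rule ccontr)
    assume "\<not> ?thesis"
    then have "(\<Sum>i\<in>?K. share RSD R i None) \<le> 0" by (intro sum_nonpos) force
    with sum show False by simp
  qed
  then obtain i is0 where i: "c \<in> acceptable (R i)"
    and is0: "is0 \<in> permutations_of_set UNIV" "serial_dictatorship is0 R UNIV i = None"
    unfolding share_RSD using positive by blast
  obtain j where j0: "serial_dictatorship is0 R UNIV j = Some c"
    using weakly_non_wasteful_assigned[OF R wnw[OF is0(1)] is0(2) i] by blast
  then have j: "c \<in> acceptable (R j)" "i \<noteq> j"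
    using weakly_non_wasteful_acceptable[OF R wnw[OF is0(1)]] is0(2) by auto
  obtain is1 where is1: "is1 \<in> permutations_of_set UNIV" "\<And>k. serial_dictatorship is1 R UNIV k \<noteq> Some c"
    using positive[of "\<lambda>is. \<forall>k. serial_dictatorship is R UNIV k \<noteq> Some c"] un by auto
  \<comment> \<open>Three agents accepting \<open>c\<close> could not all be served by the two other
    objects, so \<open>c\<close> would never stay free.\<close>
  have "card ?K \<le> 2"
  proof (rule ccontr)
    assume "\<not> ?thesis"
    moreover have "card ((\<Union>k\<in>?K. acceptable (R k)) - {c}) \<le> card (UNIV - {c})"
      by (intro card_mono) auto
    moreover have "card (UNIV - {c}) = 2" using card3 by (simp add: card_Diff_singleton)
    ultimately show False
      using weakly_non_wasteful_pigeonhole[OF R wnw[OF is1(1)] serial_dictatorship_assignments[OF R], of ?K c]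
        is1(2) by auto
  qed
  moreover have "{i, j} \<subseteq> ?K" "card {i, j} = 2" using i j by auto
  ultimately have K: "?K = {i, j}" by (metis card_seteq finite)
  have "\<exists>x. serial_dictatorship is1 R UNIV k = Some x" if "k \<in> {i, j}" for k
    using weakly_non_wasteful_assigned[OF R wnw[OF is1(1)], of k c] is1(2) that i j by auto
  then obtain a b where ab: "serial_dictatorship is1 R UNIV i = Some a" "serial_dictatorship is1 R UNIV j = Some b"
    by blast
  then have dist: "distinct [a, b, c]"
    using serial_dictatorship_assignments[OF R, of is1 UNIV] j(2) is1(2)
    by (auto simp: assignments_def)
  then have "card {a, b, c} = CARD('o)" using card3 by simp
  then have "UNIV = {a, b, c}" by (metis card_subset_eq finite subset_UNIV)
  from prob_two_take_others_le[OF R j(2) this dist K is0 is1 ab] un show False by simp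
qed

section \<open>Combination of the two bounds\<close>

lemma quarter_is_lower_bound:
  fixes f :: "('i::finite, 'o::finite) mechanism"
  assumes "CARD('i) \<ge> 4" "CARD('o) = 3" "fair_mechanism f" "at_most_object_wasteful q f"
  shows "q \<ge> 1/4"
  using fair_mechanism.object_wasteful_quarter[OF assms(3)] assms
  by (force simp: at_most_object_wasteful_def)

theorem corollary2:
  assumes "CARD('i::finite) \<ge> 4" and "CARD('o::finite) = 3"
  shows
    "attains_minimal_bound (RSD :: ('i, 'o) mechanism) (1/4)
       {f. is_mechanism f \<and> equal_treatment_of_almost_equals f \<and> strategy_proof f \<and>
           ex_post_weakly_non_wasteful f} \<and>
     attains_minimal_bound (RSD :: ('i, 'o) mechanism) (1/4)
       {f. is_mechanism f \<and> equal_treatment_of_equals f \<and> strategy_proof f \<and>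
           ex_post_efficient f}"
proof -
  have "fair_mechanism (RSD :: ('i, 'o) mechanism)"
    by (intro fair_mechanism.intro RSD_mechanism RSD_equal_treatment_of_equals RSD_strategy_proof
        RSD_ex_post_weakly_non_wasteful)
  then have "object_wasteful (1/4) (RSD :: ('i, 'o) mechanism)"
    using assms by (intro fair_mechanism.object_wasteful_quarter) auto
  moreover have "\<not> object_wasteful q (RSD :: ('i, 'o) mechanism)" if "q > 1/4" for q
  proof
    assume "object_wasteful q (RSD :: ('i, 'o) mechanism)"
    then obtain R :: "('i, 'o) profile" and x where R: "R \<in> profiles"
      and le: "q \<le> min (\<Sum>i | strictly_prefers (R i) (Some x) None. share RSD R i None)
        (unassigned_share RSD R x)"
      unfolding object_wasteful_def by blast
    from le RSD_waste_le[OF R assms(2), of x] that show False by linarith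
  qed
  ultimately have "at_most_object_wasteful (1/4) (RSD :: ('i, 'o) mechanism)"
    by (simp add: at_most_object_wasteful_def)
  then show ?thesis
    unfolding attains_minimal_bound_def
    using quarter_is_lower_bound[OF assms]
    by (auto simp: RSD_mechanism RSD_equal_treatment_of_equals RSD_strategy_proof RSD_ex_post_efficient
        RSD_ex_post_weakly_non_wasteful RSD_equal_treatment_of_almost_equals
        intro!: fair_mechanism.intro intro: equal_treatment_of_almost_equals_imp_equals
          ex_post_efficient_imp_weakly_non_wasteful)
qed

end
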